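(* Let $\alpha\in(0,1)$. Let $\mathcal{F}$ be a class of distribution functions on $\mathbb{R}$ with finite first moments and unique $\alpha$-quantiles, and let $T=(\operatorname{VaR}_\alpha,\operatorname{ES}_\alpha)$ on $\mathcal{F}$. Let $\mathsf{A}_0=\{x\in\mathbb{R}^2\colon x_1\ge x_2\}$. A scoring function $S\colon\mathsf{A}_0\times\mathbb{R}\to\mathbb{R}$ of the form $$\begin{aligned}S(x_1,x_2,y)&=\big(\mathds{1}\{y\le x_1\}-\alpha\big)G_1(x_1)-\mathds{1}\{y\le x_1\}G_1(y)\\&\quad+G_2(x_2)\Big(x_2-x_1+\frac1\alpha\mathds{1}\{y\le x_1\}(x_1-y)\Big)-\mathcal{G}_2(x_2)+a(y),\end{aligned}\tag{$*$}$$ where $G_1,G_2,\mathcal{G}_2,a\colon\mathbb{R}\to\mathbb{R}$, $\mathcal{G}_2'=G_2$, $a$ is $\mathcal{F}$-integrable and $\mathds{1}_{(-\infty,x_1]}G_1$ is $\mathcal{F}$-integrable for all $x_1\in\mathbb{R}$, is $\mathcal{F}$-consistent for $T$ if $G_1$ is increasing and $\mathcal{G}_2$ is increasing and convex. If (moreover) $\mathcal{G}_2$ is strictly increasing and strictly convex, then $S$ is strictly $\mathcal{F}$-consistent for $T$. Furthermore, assume that the elements of $\mathcal{F}$ have continuous densities, let $\mathsf{A}:=T(\mathcal{F})$, and let $V\colon\mathsf{A}\times\mathbb{R}\to\mathbb{R}^2$ be given by $V_1(x_1,x_2,y)=\mathds{1}\{y\le x_1\}-\alpha$, $V_2(x_1,x_2,y)=x_2-\frac1\alpha\,y\,\mathds{1}\{y\le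 x_1\}$. Suppose that (a) $\mathcal{F}$ is convex and the interior of $\mathsf{A}$ is a star domain; (b) for every $x\in\operatorname{int}(\mathsf{A})$ there are $F_1,F_2,F_3\in\mathcal{F}$ with $0\in\operatorname{int}\big(\operatorname{conv}(\{\bar V(x,F_1),\bar V(x,F_2),\bar V(x,F_3)\})\big)$; (c) for every $y\in\mathbb{R}$ there is a sequence $(F_n)_{n\in\mathbb{N}}$ in $\mathcal{F}$ converging weakly to the Dirac measure $\delta_y$ such that the supports of all $F_n$ are contained in one compact set $K$; (d) for all $t\in\operatorname{int}(\mathsf{A})\cap T(\mathcal{F})$ there are $F_1,F_2\in T^{-1}(\{t\})$ with $\partial_1\bar V_1(t,F_1)\ne\partial_1\bar V_1(t,F_2)$. Then every strictly $\mathcal{F}$-consistent scoring function $S\colon\mathsf{A}\times\mathbb{R}\to\mathbb{R}$ for $T$ such that (e) for every $F\in\mathcal{F}$, $\bar S(\cdot,F)$ is continuously differentiable with locally Lipschitz continuous gradient and is twice continuously differentiable at $t=T(F)$ whenever $T(F)\in\operatorname{int}(\mathsf{A})$, and (f) the complement of $\{(x,y)\in\mathsf{A}\times\mathbb{R}\colon V(x,\cdot)\text{ and }S(x,\cdot)\text{ are continuous at }y\}$ has $3$-dimensional Lebesgue measure zero, is of the form $( * )$ almost everywhere.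
   Context: $\mathds{1}$ denotes an indicator function. For a distribution function $F$ on $\mathbb{R}$, $\operatorname{VaR}_\alpha(F):=F^{-1}(\alpha):=\inf\{x\in\mathbb{R}\colon F(x)\ge\alpha\}$ and $\operatorname{ES}_\alpha(F):=\frac1\alpha\int_0^\alpha\operatorname{VaR}_u(F)\,\mathrm{d}u$ (so always $\operatorname{ES}_\alpha(F)\le\operatorname{VaR}_\alpha(F)$). A function on $\mathbb{R}$ is $\mathcal{F}$-integrable if it is $F$-integrable for each $F\in\mathcal{F}$; a function $g$ on $\mathsf{A}\times\mathbb{R}$, $\mathsf{A}\subseteq\mathbb{R}^2$, is $\mathcal{F}$-integrable if $g(x,\cdot)$ is $\mathcal{F}$-integrable for each $x\in\mathsf{A}$, and then $\bar g(x,F):=\int g(x,y)\,\mathrm{d}F(y)$ (componentwise if vector-valued). For a functional $T\colon\mathcal{F}\to\mathsf{A}$: a scoring function is an $\mathcal{F}$-integrable $S\colon\mathsf{A}\times\mathbb{R}\to\mathbb{R}$; it is $\mathcal{F}$-consistent for $T$ if $\bar S(T(F),F)\le\bar S(x,F)$ for all $F\in\mathcal{F}$, $x\in\mathsf{A}$, and strictly $\mathcal{F}$-consistent if in addition equality implies $x=T(F)$. Standing assumption: scoring functions $S$ are such that $S(x,\cdot)$ is locally bounded for all $x$, wherever this is needed. "Increasing" means non-decreasing. $T(\mathcal{F})$ is the image of $T$; $\operatorname{int}$ is the interior in $\mathbb{R}^2$, $\operatorname{conv}$ the convex hull, $\partial_l$ the partial derivative with respect to $x_l$. Differentiability properties of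 a function on $\mathsf{A}$ are understood on $\operatorname{int}(\mathsf{A})$. A star domain is a set containing a point $z$ such that the segment from $z$ to any of its points lies in the set. "Almost everywhere" refers to Lebesgue measure on $\mathsf{A}\times\mathbb{R}$.
   Formalization: In the last claim, "of the form (∗)" means the formula with 𝒢₂′ = G₂ only; the 𝓕-integrability of a and of 1_{(-∞,x₁]}G₁ is not asserted there, since it can fail (e.g. G₁(x) = 1 − exp(x⁴) for x<0, a = 1_{(-∞,0]}G₁, heavy-tailed F). *)

theory Defs
  imports "HOL-Probability.Probability"
begin

definition distribution_function :: "(real \<Rightarrow> real) \<Rightarrow> bool" where
  "distribution_function F \<longleftrightarrow>
     mono F \<and> (\<forall>x. continuous (at_right x) F) \<and> (F \<longlongrightarrow> 0) at_bot \<and> (F \<longlongrightarrow> 1) at_top"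

text \<open>Integration with respect to a distribution function \<open>F\<close> is integration with respect to the
  Lebesgue--Stieltjes measure \<^term>\<open>interval_measure F\<close>.\<close>

definition finite_first_moment :: "(real \<Rightarrow> real) \<Rightarrow> bool" where
  "finite_first_moment F \<longleftrightarrow> integrable (interval_measure F) (\<lambda>y. y)"

definition is_quantile :: "real \<Rightarrow> (real \<Rightarrow> real) \<Rightarrow> real \<Rightarrow> bool" where
  "is_quantile \<alpha> F q \<longleftrightarrow> measure (interval_measure F) {..<q} \<le> \<alpha> \<and> \<alpha> \<le> F q"

definition VaR :: "real \<Rightarrow> (real \<Rightarrow> real) \<Rightarrow> real" where
  "VaR \<alpha> F = Inf {x. \<alpha> \<le> F x}"

text \<open>The open interval avoids the undefined value \<^term>\<open>VaR 0 F\<close>.\<close>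

definition ES :: "real \<Rightarrow> (real \<Rightarrow> real) \<Rightarrow> real" where
  "ES \<alpha> F = 1 / \<alpha> * (LINT u:{0<..<\<alpha>}|lborel. VaR u F)"

definition VaR_ES :: "real \<Rightarrow> (real \<Rightarrow> real) \<Rightarrow> real \<times> real" where
  "VaR_ES \<alpha> F = (VaR \<alpha> F, ES \<alpha> F)"

definition has_continuous_density :: "(real \<Rightarrow> real) \<Rightarrow> bool" where
  "has_continuous_density F \<longleftrightarrow>
     (\<exists>f. continuous_on UNIV f \<and> (\<forall>y. 0 \<le> f y) \<and>
          interval_measure F = density lborel (\<lambda>y. ennreal (f y)))"

definition dist_support :: "(real \<Rightarrow> real) \<Rightarrow> real set" where
  "dist_support F = \<Inter>{C. closed C \<and> emeasure (interval_measure F) (- C) = 0}"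

definition convex_class :: "(real \<Rightarrow> real) set \<Rightarrow> bool" where
  "convex_class \<F> \<longleftrightarrow>
     (\<forall>F\<in>\<F>. \<forall>G\<in>\<F>. \<forall>l\<in>{0..1}. (\<lambda>y. (1 - l) * F y + l * G y) \<in> \<F>)"

definition class_integrable :: "(real \<Rightarrow> real) set \<Rightarrow> (real \<Rightarrow> real) \<Rightarrow> bool" where
  "class_integrable \<F> g \<longleftrightarrow> (\<forall>F\<in>\<F>. integrable (interval_measure F) g)"

definition expected ::
  "('x \<Rightarrow> real \<Rightarrow> 'b::{banach, second_countable_topology}) \<Rightarrow> 'x \<Rightarrow> (real \<Rightarrow> real) \<Rightarrow> 'b" where
  "expected g x F = (\<integral>y. g x y \<partial>interval_measure F)"

definition scoring_function ::
  "(real \<Rightarrow> real) set \<Rightarrow> 'x set \<Rightarrow> ('x \<Rightarrow> real \<Rightarrow> real) \<Rightarrow> bool" where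
  "scoring_function \<F> A S \<longleftrightarrow> (\<forall>x\<in>A. class_integrable \<F> (S x))"

definition consistent ::
  "(real \<Rightarrow> real) set \<Rightarrow> 'x set \<Rightarrow> ((real \<Rightarrow> real) \<Rightarrow> 'x) \<Rightarrow> ('x \<Rightarrow> real \<Rightarrow> real) \<Rightarrow> bool" where
  "consistent \<F> A T S \<longleftrightarrow> (\<forall>F\<in>\<F>. \<forall>x\<in>A. expected S (T F) F \<le> expected S x F)"

definition strictly_consistent ::
  "(real \<Rightarrow> real) set \<Rightarrow> 'x set \<Rightarrow> ((real \<Rightarrow> real) \<Rightarrow> 'x) \<Rightarrow> ('x \<Rightarrow> real \<Rightarrow> real) \<Rightarrow> bool" where
  "strictly_consistent \<F> A T S \<longleftrightarrow>
     consistent \<F> A T S \<and>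
     (\<forall>F\<in>\<F>. \<forall>x\<in>A. expected S (T F) F = expected S x F \<longrightarrow> x = T F)"

definition locally_bounded :: "(real \<Rightarrow> real) \<Rightarrow> bool" where
  "locally_bounded g \<longleftrightarrow> (\<forall>y. \<exists>U. open U \<and> y \<in> U \<and> bounded (g ` U))"

definition strictly_convex :: "(real \<Rightarrow> real) \<Rightarrow> bool" where
  "strictly_convex f \<longleftrightarrow>
     (\<forall>x y l. x \<noteq> y \<longrightarrow> 0 < l \<longrightarrow> l < 1 \<longrightarrow>
        f ((1 - l) * x + l * y) < (1 - l) * f x + l * f y)"

text \<open>Continuously differentiable on \<open>U\<close> with locally Lipschitz gradient \<open>g\<close>, and, if \<open>t \<in> U\<close>, twice
  continuously differentiable at \<open>t\<close>: the second derivative \<open>H\<close> exists in a neighbourhood of \<open>t\<close>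
  and is continuous at \<open>t\<close>.\<close>

definition score_smooth :: "(real \<times> real) set \<Rightarrow> real \<times> real \<Rightarrow> (real \<times> real \<Rightarrow> real) \<Rightarrow> bool" where
  "score_smooth U t f \<longleftrightarrow>
     (\<exists>g. (\<forall>x\<in>U. GDERIV f x :> g x) \<and>
          continuous_on U g \<and>
          (\<forall>x\<in>U. \<exists>e>0. \<exists>L. L-lipschitz_on (ball x e \<inter> U) g) \<and>
          (t \<in> U \<longrightarrow>
            (\<exists>N H. open N \<and> t \<in> N \<and> N \<subseteq> U \<and>
               (\<forall>x\<in>N. (g has_derivative blinfun_apply (H x)) (at x)) \<and>
               isCont H t)))"

definition A0 :: "(real \<times> real) set" where
  "A0 = {(x1, x2). x1 \<ge> x2}"

text \<open>\<open>GG2\<close> is meant to be an antiderivative of \<open>G2\<close>; this is required where the score is used.\<close>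

definition var_es_score ::
  "real \<Rightarrow> (real \<Rightarrow> real) \<Rightarrow> (real \<Rightarrow> real) \<Rightarrow> (real \<Rightarrow> real) \<Rightarrow> (real \<Rightarrow> real) \<Rightarrow>
   real \<times> real \<Rightarrow> real \<Rightarrow> real" where
  "var_es_score \<alpha> G1 G2 GG2 a = (\<lambda>(x1, x2) y.
     (indicator {..x1} y - \<alpha>) * G1 x1 - indicator {..x1} y * G1 y
     + G2 x2 * (x2 - x1 + 1 / \<alpha> * indicator {..x1} y * (x1 - y))
     - GG2 x2 + a y)"

definition ident_V :: "real \<Rightarrow> real \<times> real \<Rightarrow> real \<Rightarrow> real \<times> real" where
  "ident_V \<alpha> = (\<lambda>(x1, x2) y.
     (indicator {..x1} y - \<alpha>, x2 - 1 / \<alpha> * y * indicator {..x1} y))"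

definition partial1_V1 :: "real \<Rightarrow> real \<times> real \<Rightarrow> (real \<Rightarrow> real) \<Rightarrow> real" where
  "partial1_V1 \<alpha> t F = deriv (\<lambda>s. fst (expected (ident_V \<alpha>) (s, snd t) F)) (fst t)"

end

theory Submission
  imports Defs
begin

text \<open>
  Write \<open>W F x = x\<^sub>2 - x\<^sub>1 + lpm F x\<^sub>1 / \<alpha>\<close> with the lower partial moment \<open>lpm F z = E (z - Y)\<^sup>+\<close>.
  The quantile transform gives \<open>ES = VaR - lpm F VaR / \<alpha>\<close>, so \<open>W\<close> vanishes at \<open>(VaR, ES)\<close>, and sufficiency reduces to
  two facts: quantiles minimise both expected quantile scores (the one for \<open>G1\<close> and the one for the
  identity), and \<open>GG2\<close> lies above its tangents.

  For necessity, mixtures of three distributions close to Dirac measures show that the action domain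
  is the whole open half plane \<open>x\<^sub>2 < x\<^sub>1\<close>, and the same mixtures yield Osband's principle: the gradient
  of the expected score is a matrix \<open>h x\<close> applied to \<open>(F x\<^sub>1 - \<alpha>, W F x)\<close>. Symmetry of the Hessian at
  \<open>T F = x\<close> together with two different densities at \<open>x\<^sub>1\<close> makes \<open>h\<close> diagonal. Instead of
  differentiating \<open>h\<close>, which is only locally Lipschitz, we integrate the gradient around a rectangle
  and let \<open>F\<close> tend to Dirac measures left and right of it; this determines \<open>h\<close>
  up to one function of \<open>x\<^sub>1\<close> and one of \<open>x\<^sub>2\<close>. Hence the expected score and the expected score of
  the form \<open>(*)\<close> differ by a constant in \<open>x\<close>, and a last passage to Dirac measures transfers this to
  the scores themselves at points of continuity.
\<close>

section \<open>Partial moments and expected shortfall\<close>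

lemma distribution_functionD:
  assumes "distribution_function F"
  shows "mono F" "\<And>a. continuous (at_right a) F" "(F \<longlongrightarrow> 0) at_bot" "(F \<longlongrightarrow> 1) at_top"
  using assms by (auto simp: distribution_function_def)

lemma real_distribution_distribution_function:
  assumes "distribution_function F"
  shows "real_distribution (interval_measure F)"
  using distribution_functionD[OF assms]
  by (intro real_distribution_interval_measure) (auto simp: mono_def)

lemma cdf_distribution_function:
  assumes "distribution_function F"
  shows "cdf (interval_measure F) = F"
  using distribution_functionD[OF assms]
  by (intro cdf_interval_measure) (auto simp: mono_def)

lemma measure_atMost_distribution_function:
  assumes "distribution_function F"
  shows "measure (interval_measure F) {..x} = F x"
  using cdf_distribution_function[OF assms] by (simp add: cdf_def fun_eq_iff)

text \<open>Right continuity makes the infimum in \<open>VaR\<close> attained, so \<open>VaR\<close>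
  and \<open>F\<close> form a Galois connection. The bounds on \<open>u\<close> make the set under
  the infimum nonempty and bounded below.\<close>

lemma VaR_le_iff:
  assumes F: "distribution_function F" and u: "0 < u" "u < 1"
  shows "VaR u F \<le> x \<longleftrightarrow> u \<le> F x"
proof -
  interpret right_continuous_mono F 0 1
    by unfold_locales (rule distribution_functionD[OF F])+
  show ?thesis
    unfolding VaR_def by (rule pseudoinverse[OF u, symmetric])
qed

lemma is_quantile_VaR:
  assumes F: "distribution_function F" and a: "0 < \<alpha>" "\<alpha> < 1"
  shows "is_quantile \<alpha> F (VaR \<alpha> F)"
proof -
  interpret M: real_distribution "interval_measure F"
    by (rule real_distribution_distribution_function[OF F])
  \<comment> \<open>Left of the infimum \<open>F\<close> stays below \<alpha>, and the left limit of
    \<open>F\<close> at \<open>VaR \<alpha> F\<close> is the mass of the open half-line.\<close>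
  have "eventually (\<lambda>x. cdf (interval_measure F) x \<le> \<alpha>) (at_left (VaR \<alpha> F))"
    unfolding cdf_distribution_function[OF F] eventually_at_left_field
    using VaR_le_iff[OF F a] by (metis less_eq_real_def linorder_not_less lt_ex)
  then have "measure (interval_measure F) {..<VaR \<alpha> F} \<le> \<alpha>"
    by (intro tendsto_upperbound[OF M.cdf_at_left]) auto
  then show ?thesis
    using VaR_le_iff[OF F a, of "VaR \<alpha> F"] by (simp add: is_quantile_def)
qed

definition lpm :: "(real \<Rightarrow> real) \<Rightarrow> real \<Rightarrow> real" where
  "lpm F x = (\<integral>y. max 0 (x - y) \<partial>interval_measure F)"

lemma integrable_lpm:
  assumes F: "distribution_function F" "finite_first_moment F"
  shows "integrable (interval_measure F) (\<lambda>y. max 0 (x - y))"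
proof -
  interpret M: real_distribution "interval_measure F"
    by (rule real_distribution_distribution_function[OF F(1)])
  have "integrable (interval_measure F) (\<lambda>y. y)"
    using F(2) by (simp add: finite_first_moment_def)
  then show ?thesis
    by (intro integrable_max Bochner_Integration.integrable_diff) auto
qed

lemma lpm_nonneg: "0 \<le> lpm F x"
  unfolding lpm_def by (intro integral_nonneg_AE) auto

text \<open>For \<open>u\<close> uniform on the open unit interval, \<open>VaR u F\<close> has law
  \<open>F\<close>. Since \<open>VaR u F\<close> increases in \<open>u\<close>, the positive part of
  \<open>q - VaR u F\<close> lives on \<open>u < \<alpha>\<close>; its mean \<open>lpm F q\<close>
  is therefore \<open>\<alpha> * q\<close> minus the integral that defines
  \<open>ES\<close>.\<close>

lemma ES_eq_lpm:
  assumes F: "distribution_function F" "finite_first_moment F" and a: "0 < \<alpha>" "\<alpha> < 1"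
  shows "ES \<alpha> F = VaR \<alpha> F - lpm F (VaR \<alpha> F) / \<alpha>"
proof -
  define q where "q = VaR \<alpha> F"
  interpret M: cdf_distribution "interval_measure F"
    unfolding cdf_distribution_def by (rule real_distribution_distribution_function[OF F(1)])
  define R where "R = restrict_space lborel {0<..<1::real}"
  define I where "I = (\<lambda>u. VaR u F)"
  have [measurable]: "I \<in> borel_measurable R"
    using M.measurable_CI unfolding R_def I_def VaR_def cdf_distribution_function[OF F(1)]
    by (simp cong: measurable_cong_sets add: sets_restrict_space)
  have distr: "distr R borel I = interval_measure F"
    using M.distr_I_eq_M unfolding R_def I_def VaR_def cdf_distribution_function[OF F(1)] .
  have "integrable (distr R borel I) (\<lambda>y. y)"
    using F(2) by (simp add: finite_first_moment_def distr)
  then have "integrable R I"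
    by (subst (asm) integrable_distr_eq) auto
  then have "set_integrable lborel {0<..<1} I"
    unfolding R_def set_integrable_def by (subst (asm) integrable_restrict_space) auto
  then have int: "set_integrable lborel {0<..<\<alpha>} I"
    by (rule set_integrable_subset) (use a in auto)
  have intq: "set_integrable lborel {0<..<\<alpha>} (\<lambda>u. q)"
    using a by (simp add: set_integrable_def integrable_real_indicator)
  have "lpm F q = (\<integral>y. max 0 (q - y) \<partial>distr R borel I)"
    by (simp add: lpm_def distr)
  also have "\<dots> = (\<integral>u. max 0 (q - I u) \<partial>R)"
    by (subst integral_distr) auto
  also have "\<dots> = (LINT u:{0<..<1}|lborel. max 0 (q - I u))"
    unfolding R_def set_lebesgue_integral_def by (subst integral_restrict_space) auto
  also have "\<dots> = (LINT u:{0<..<\<alpha>}|lborel. q - I u)"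
  proof -
    have "max 0 (q - I u) * indicator {0<..<1} u = (q - I u) * indicator {0<..<\<alpha>} u"
      if "u \<noteq> \<alpha>" for u
    proof (cases "u \<in> {0<..<1}")
      case True
      show ?thesis
      proof (cases "u < \<alpha>")
        case True
        have "I u \<le> q"
          using \<open>u \<in> _\<close> a True VaR_le_iff[OF F(1) a, of q] VaR_le_iff[OF F(1), of u q]
          by (simp add: I_def q_def)
        then show ?thesis using True \<open>u \<in> _\<close> by auto
      next
        case False
        have "q \<le> I u"
          using \<open>u \<in> _\<close> a False VaR_le_iff[OF F(1) a, of "I u"] VaR_le_iff[OF F(1), of u "I u"]
          by (simp add: I_def q_def)
        then show ?thesis using False by auto
      qed
    qed (use a in \<open>auto simp: indicator_def\<close>)
    then have "AE u in lborel. indicator {0<..<1} u *\<^sub>R max 0 (q - I u) =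
        indicator {0<..<\<alpha>} u *\<^sub>R (q - I u)"
      using AE_lborel_singleton[of \<alpha>] by (auto simp: mult.commute)
    \<comment> \<open>Measurability of \<open>I\<close> is available on the restriction to the open
      unit interval; the indicator carries it to the whole line.\<close>
    moreover have "(\<lambda>u. indicator {0<..<1} u *\<^sub>R max 0 (q - I u)) \<in> borel_measurable lborel"
    proof -
      have "(\<lambda>u. max 0 (q - I u)) \<in> borel_measurable R" by measurable
      then show ?thesis
        unfolding R_def by (subst (asm) borel_measurable_restrict_space_iff) auto
    qed
    moreover have "(\<lambda>u. indicator {0<..<\<alpha>} u *\<^sub>R (q - I u)) \<in> borel_measurable lborel"
    proof -
      have "set_integrable lborel {0<..<\<alpha>} (\<lambda>u. q - I u)"
        using intq int by (intro set_integral_diff)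
      then show ?thesis by (auto simp: set_integrable_def)
    qed
    ultimately show ?thesis
      unfolding set_lebesgue_integral_def by (intro integral_cong_AE)
  qed
  also have "\<dots> = (LINT u:{0<..<\<alpha>}|lborel. q) - (LINT u:{0<..<\<alpha>}|lborel. I u)"
    using intq int by (intro set_integral_diff)
  also have "(LINT u:{0<..<\<alpha>}|lborel. q) = \<alpha> * q"
    using a by (simp add: set_lebesgue_integral_def)
  finally show ?thesis
    using a by (simp add: ES_def q_def I_def field_simps)
qed

section \<open>Quantiles as minimisers of expected quantile scores\<close>

text \<open>The difference of the scores at \<open>x\<close> and \<open>q\<close> dominates
  \<open>(indicator B y - \<alpha>) * (G x - G q)\<close> pointwise. The mean of the latter is a
  product of two factors of equal sign, because \<open>q\<close> is a quantile and \<open>G\<close>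
  is monotone.\<close>

lemma quantile_score_minimal:
  assumes F: "distribution_function F" and q: "is_quantile \<alpha> F q" and G: "mono G"
    and int: "\<And>x. integrable (interval_measure F) (\<lambda>y. indicator {..x} y * G y)"
  defines "R \<equiv> \<lambda>x y. (indicator {..x} y - \<alpha>) * G x - indicator {..x} y * G y"
  shows "(\<integral>y. R q y \<partial>interval_measure F) \<le> (\<integral>y. R x y \<partial>interval_measure F)"
proof -
  interpret M: real_distribution "interval_measure F"
    by (rule real_distribution_distribution_function[OF F])
  have intR: "integrable (interval_measure F) (R x)" for x
    unfolding R_def using int[of x]
    by (intro Bochner_Integration.integrable_diff integrable_mult_left)
       (auto simp: M.emeasure_finite less_top[symmetric])
  \<comment> \<open>For \<open>x\<close> to the right of \<open>q\<close> the relevant half of the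
    quantile property is \<open>\<alpha> \<le> F q\<close>; to the left it is the bound on the mass
    of the open half-line.\<close>
  define B where "B = (if q \<le> x then {..q} else {..<q})"
  have "0 \<le> (measure (interval_measure F) B - \<alpha>) * (G x - G q)"
    using q monoD[OF G, of q x] monoD[OF G, of x q]
    by (auto simp: B_def is_quantile_def measure_atMost_distribution_function[OF F]
        intro!: mult_nonneg_nonneg mult_nonpos_nonpos)
  also have "\<dots> = (\<integral>y. (indicator B y - \<alpha>) * (G x - G q) \<partial>interval_measure F)"
    using M.prob_space by (subst integral_mult_left_zero, subst Bochner_Integration.integral_diff)
      (auto simp: B_def M.emeasure_finite less_top[symmetric])
  also have "\<dots> \<le> (\<integral>y. R x y - R q y \<partial>interval_measure F)"
  proof (intro integral_mono Bochner_Integration.integrable_diff intR integrable_mult_left)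
    show "(indicator B y - \<alpha>) * (G x - G q) \<le> R x y - R q y" for y
      using monoD[OF G, of y x] monoD[OF G, of y q] monoD[OF G, of x y] monoD[OF G, of q y]
      by (auto simp: B_def R_def indicator_def algebra_simps)
  qed (auto simp: B_def M.emeasure_finite less_top[symmetric])
  also have "\<dots> = (\<integral>y. R x y \<partial>interval_measure F) - (\<integral>y. R q y \<partial>interval_measure F)"
    by (intro Bochner_Integration.integral_diff intR)
  finally show ?thesis by simp
qed

text \<open>The two values of \<open>p\<close> are the right and the left derivative of the convex
  function \<open>lpm F\<close> at \<open>z\<close>. The inequality is the mean over
  \<open>y\<close> of the subgradient inequality for \<open>max 0 (x - y)\<close>.\<close>

lemma lpm_subgradient:
  assumes F: "distribution_function F" "finite_first_moment F"
    and p: "p = F z \<or> p = measure (interval_measure F) {..<z}"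
  shows "p * (x - z) \<le> lpm F x - lpm F z"
proof -
  interpret M: real_distribution "interval_measure F"
    by (rule real_distribution_distribution_function[OF F(1)])
  define B where "B = (if p = F z then {..z} else {..<z})"
  have [measurable]: "B \<in> sets borel" by (auto simp: B_def)
  have intB: "integrable (interval_measure F) (\<lambda>y. indicator B y * (x - z))"
    by (intro integrable_mult_left integrable_real_indicator)
      (auto simp: M.emeasure_finite less_top[symmetric])
  have "p * (x - z) = (\<integral>y. indicator B y * (x - z) \<partial>interval_measure F)"
    using p by (auto simp: B_def measure_atMost_distribution_function[OF F(1)])
  also have "\<dots> \<le> (\<integral>y. max 0 (x - y) - max 0 (z - y) \<partial>interval_measure F)"
    by (intro integral_mono Bochner_Integration.integrable_diff integrable_lpm F intB)
       (auto simp: B_def indicator_def)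
  also have "\<dots> = lpm F x - lpm F z"
    unfolding lpm_def by (intro Bochner_Integration.integral_diff integrable_lpm F)
  finally show ?thesis .
qed

text \<open>The function \<open>lpm F x - \<alpha> * x\<close> is the expected quantile score with
  the identity for \<open>G1\<close>. It is convex in \<open>x\<close>, and at a quantile \<alpha>
  lies between the one-sided derivatives of \<open>lpm F\<close>.\<close>

lemma lpm_minimal:
  assumes F: "distribution_function F" "finite_first_moment F" and q: "is_quantile \<alpha> F q"
  shows "lpm F q - \<alpha> * q \<le> lpm F x - \<alpha> * x"
proof (cases "q \<le> x")
  case True
  have "\<alpha> * (x - q) \<le> F q * (x - q)"
    using q True by (auto simp: is_quantile_def intro!: mult_right_mono)
  with lpm_subgradient[OF F, of "F q" q x] show ?thesis by (simp add: algebra_simps)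
next
  case False
  have "\<alpha> * (x - q) \<le> measure (interval_measure F) {..<q} * (x - q)"
    using q False by (auto simp: is_quantile_def intro!: mult_right_mono_neg)
  with lpm_subgradient[OF F, of "measure (interval_measure F) {..<q}" q x]
  show ?thesis by (simp add: algebra_simps)
qed

lemma lpm_strictly_minimal:
  assumes F: "distribution_function F" "finite_first_moment F" and a: "0 < \<alpha>" "\<alpha> < 1"
    and uq: "\<exists>!q. is_quantile \<alpha> F q" and x: "x \<noteq> VaR \<alpha> F"
  shows "lpm F (VaR \<alpha> F) - \<alpha> * VaR \<alpha> F < lpm F x - \<alpha> * x"
proof -
  interpret M: real_distribution "interval_measure F"
    by (rule real_distribution_distribution_function[OF F(1)])
  define q where "q = VaR \<alpha> F"
  have q: "is_quantile \<alpha> F q"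
    unfolding q_def by (rule is_quantile_VaR[OF F(1) a])
  have le: "measure (interval_measure F) {..<z} \<le> F z" for z
  proof -
    have "measure (interval_measure F) {..<z} \<le> measure (interval_measure F) {..z}"
      by (intro M.finite_measure_mono) auto
    then show ?thesis by (simp add: measure_atMost_distribution_function[OF F(1)])
  qed
  \<comment> \<open>From \<open>q\<close> to the midpoint \<open>z\<close> minimality of
    \<open>q\<close> suffices. At \<open>z\<close> the slope \<open>F z\<close> differs strictly
    from \<alpha>, in the direction that makes the function grow strictly from \<open>z\<close> to
    \<open>x\<close>.\<close>
  define z where "z = (q + x) / 2"
  have "\<alpha> * (x - z) < F z * (x - z)"
  proof (cases "q < x")
    case True
    have "\<not> is_quantile \<alpha> F z"
    proof
      assume "is_quantile \<alpha> F z"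
      then have "z = q" using uq q by blast
      then show False using True by (simp add: z_def)
    qed
    moreover have "\<alpha> \<le> F z"
      using q monoD[OF distribution_functionD(1)[OF F(1)], of q z] True
      by (auto simp: is_quantile_def z_def)
    ultimately have "\<alpha> < F z"
      using le[of z] by (auto simp: is_quantile_def)
    then show ?thesis using True by (intro mult_strict_right_mono) (auto simp: z_def)
  next
    case False
    then have "z < q" using x by (auto simp: z_def q_def)
    then have "F z < \<alpha>" using VaR_le_iff[OF F(1) a, of z] by (simp add: q_def)
    then show ?thesis
      using False x by (intro mult_strict_right_mono_neg) (auto simp: z_def q_def)
  qed
  with lpm_subgradient[OF F, of "F z" z x] lpm_minimal[OF F q, of z] show ?thesis
    by (simp add: algebra_simps q_def)
qed

section \<open>Sufficiency\<close>

lemma convex_on_above_tangent: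
  assumes "convex_on UNIV f" "(f has_real_derivative D) (at x)"
  shows "f x + D * (z - x) \<le> f z"
  using convex_on_imp_above_tangent[OF assms(1), of x z D] assms(2) by (simp add: algebra_simps)

lemma strictly_convex_imp_convex_on:
  assumes "strictly_convex f"
  shows "convex_on UNIV f"
proof (rule convex_onI)
  fix t x y :: real assume "0 < t" "t < 1"
  then show "f ((1 - t) *\<^sub>R x + t *\<^sub>R y) \<le> (1 - t) * f x + t * f y"
    using assms[unfolded strictly_convex_def, rule_format, of x y t]
    by (cases "x = y") (auto simp flip: distrib_right)
qed simp

text \<open>The tangent at \<open>x\<close> bounds \<open>f\<close> from below at the midpoint of
  \<open>x\<close> and \<open>z\<close>, and strict convexity puts that value strictly below the
  chord.\<close>

lemma strictly_convex_above_tangent: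
  assumes f: "strictly_convex f" "(f has_real_derivative D) (at x)" and "z \<noteq> x"
  shows "f x + D * (z - x) < f z"
proof -
  have "f x + D * ((x + z) / 2 - x) \<le> f ((x + z) / 2)"
    by (intro convex_on_above_tangent strictly_convex_imp_convex_on f)
  also have "\<dots> < (f x + f z) / 2"
    using f(1)[unfolded strictly_convex_def, rule_format, of x z "1/2"] \<open>z \<noteq> x\<close>
    by (simp add: field_simps)
  finally show ?thesis by (simp add: field_simps)
qed

lemma fst_VaR_ES [simp]: "fst (VaR_ES \<alpha> F) = VaR \<alpha> F"
  and snd_VaR_ES [simp]: "snd (VaR_ES \<alpha> F) = ES \<alpha> F"
  by (simp_all add: VaR_ES_def)

text \<open>Written with a positive part, the factor of \<open>G2\<close> has an expectation in
  terms of \<open>lpm\<close>.\<close>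

lemma var_es_score_eq:
  "var_es_score \<alpha> G1 G2 GG2 a x y =
     (indicator {..fst x} y - \<alpha>) * G1 (fst x) - indicator {..fst x} y * G1 y
     + G2 (snd x) * (snd x - fst x + max 0 (fst x - y) / \<alpha>) - GG2 (snd x) + a y"
  by (auto simp: var_es_score_def case_prod_beta indicator_def)

definition qscore :: "real \<Rightarrow> (real \<Rightarrow> real) \<Rightarrow> real \<Rightarrow> (real \<Rightarrow> real) \<Rightarrow> real" where
  "qscore \<alpha> G1 x F =
     (\<integral>y. (indicator {..x} y - \<alpha>) * G1 x - indicator {..x} y * G1 y \<partial>interval_measure F)"

lemma expected_var_es_score:
  assumes F: "distribution_function F" "finite_first_moment F"
    and G1: "integrable (interval_measure F) (\<lambda>y. indicator {..fst x} y * G1 y)"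
    and a: "integrable (interval_measure F) a"
  shows "expected (var_es_score \<alpha> G1 G2 GG2 a) x F =
    qscore \<alpha> G1 (fst x) F + G2 (snd x) * (snd x - fst x + lpm F (fst x) / \<alpha>) - GG2 (snd x)
    + (\<integral>y. a y \<partial>interval_measure F)"
proof -
  interpret M: real_distribution "interval_measure F"
    by (rule real_distribution_distribution_function[OF F(1)])
  note M.integrable_const[simp]
  have 1: "integrable (interval_measure F)
      (\<lambda>y. (indicator {..fst x} y - \<alpha>) * G1 (fst x) - indicator {..fst x} y * G1 y)"
    using G1 by (intro Bochner_Integration.integrable_diff integrable_mult_left integrable_real_indicator)
       (auto simp: M.emeasure_finite less_top[symmetric])
  have 2: "integrable (interval_measure F) (\<lambda>y. snd x - fst x + max 0 (fst x - y) / \<alpha>)"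
    using integrable_lpm[OF F, of "fst x"] by auto
  have "(\<integral>y. snd x - fst x + max 0 (fst x - y) / \<alpha> \<partial>interval_measure F) =
      snd x - fst x + lpm F (fst x) / \<alpha>"
    using integrable_lpm[OF F, of "fst x"] M.prob_space
    by (subst Bochner_Integration.integral_add) (auto simp: lpm_def)
  then show ?thesis
    using 1 2 a integrable_mult_right[OF 2, of "G2 (snd x)"] M.prob_space
    by (simp add: expected_def var_es_score_eq qscore_def
        Bochner_Integration.integral_add Bochner_Integration.integral_diff)
qed

text \<open>The excess of the expected score over its value at \<open>VaR_ES\<close> is a sum of
  three nonnegative terms: the excess of the quantile score for \<open>G1\<close>, the excess of the
  quantile score for the identity weighted by \<open>G2 (snd x) / \<alpha>\<close>, and the Bregman
  distance of \<open>GG2\<close> between \<open>ES \<alpha> F\<close> and \<open>snd x\<close>. In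
  the strict case the second term detects a wrong \<open>fst x\<close> and the third a wrong
  \<open>snd x\<close>.\<close>

lemma VaR_ES_score_consistent:
  assumes a: "0 < \<alpha>" "\<alpha> < 1"
    and \<F>: "\<forall>F\<in>\<F>. distribution_function F \<and> finite_first_moment F \<and> (\<exists>!q. is_quantile \<alpha> F q)"
    and S: "\<forall>x\<in>A0. \<forall>y. S x y = var_es_score \<alpha> G1 G2 GG2 a x y"
    and GG2: "\<forall>z. (GG2 has_real_derivative G2 z) (at z)"
    and int_a: "class_integrable \<F> a"
    and int_G1: "\<forall>x1. class_integrable \<F> (\<lambda>y. indicator {..x1} y * G1 y)"
    and mono: "mono G1" "mono GG2" and conv: "convex_on UNIV GG2"
  shows "consistent \<F> A0 (VaR_ES \<alpha>) S"
    and "strict_mono GG2 \<Longrightarrow> strictly_convex GG2 \<Longrightarrow> strictly_consistent \<F> A0 (VaR_ES \<alpha>) S"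
proof -
  note tangent = convex_on_above_tangent[OF conv GG2[rule_format]]
  have key: "expected S x F - expected S (VaR_ES \<alpha> F) F =
      (qscore \<alpha> G1 (fst x) F - qscore \<alpha> G1 (VaR \<alpha> F) F)
      + G2 (snd x) / \<alpha> * (lpm F (fst x) - \<alpha> * fst x - (lpm F (VaR \<alpha> F) - \<alpha> * VaR \<alpha> F))
      + (GG2 (ES \<alpha> F) - GG2 (snd x) - G2 (snd x) * (ES \<alpha> F - snd x))"
    if F: "F \<in> \<F>" and x: "x \<in> A0" for F x
  proof -
    have F': "distribution_function F" "finite_first_moment F" using \<F> F by auto
    have ES: "ES \<alpha> F = VaR \<alpha> F - lpm F (VaR \<alpha> F) / \<alpha>" by (rule ES_eq_lpm[OF F' a])
    then have T: "VaR_ES \<alpha> F \<in> A0"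
      using lpm_nonneg a by (simp add: VaR_ES_def A0_def)
    have "expected S z F = qscore \<alpha> G1 (fst z) F
        + G2 (snd z) * (snd z - fst z + lpm F (fst z) / \<alpha>) - GG2 (snd z)
        + (\<integral>y. a y \<partial>interval_measure F)" if "z \<in> A0" for z
    proof -
      have "expected S z F = expected (var_es_score \<alpha> G1 G2 GG2 a) z F"
        using S that by (simp add: expected_def)
      then show ?thesis
        using expected_var_es_score[OF F'] int_a int_G1 F by (simp add: class_integrable_def)
    qed
    note Sx = this[OF x] and ST = this[OF T]
    define D where "D = lpm F (fst x) - \<alpha> * fst x - (lpm F (VaR \<alpha> F) - \<alpha> * VaR \<alpha> F)"
    \<comment> \<open>By the formula for \<open>ES\<close>, the factor of \<open>G2\<close> splits
      into the excess \<open>D\<close> of the identity's quantile score and the deviation of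
      \<open>snd x\<close> from \<open>ES \<alpha> F\<close>.\<close>
    have W: "snd x - fst x + lpm F (fst x) / \<alpha> = D / \<alpha> - (ES \<alpha> F - snd x)"
      using a by (simp add: D_def ES field_simps)
    have W0: "ES \<alpha> F - VaR \<alpha> F + lpm F (VaR \<alpha> F) / \<alpha> = 0"
      by (simp add: ES)
    show ?thesis
      unfolding D_def[symmetric] Sx ST W W0 fst_VaR_ES snd_VaR_ES by (simp add: algebra_simps)
  qed
  \<comment> \<open>The tangent at \<open>z\<close> lies below \<open>GG2\<close> at
    \<open>z - 1\<close>, so \<open>G2 z\<close> is at least the increment of \<open>GG2\<close>
    over that unit step.\<close>
  have G2_nonneg: "0 \<le> G2 z" for z
    using tangent[of z "z - 1"] monoD[OF mono(2), of "z - 1" z] by simp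
  have 1: "0 \<le> qscore \<alpha> G1 (fst x) F - qscore \<alpha> G1 (VaR \<alpha> F) F" if "F \<in> \<F>" for F x
    using quantile_score_minimal[of F \<alpha> "VaR \<alpha> F" G1 "fst x"] is_quantile_VaR[of F \<alpha>] \<F> that a mono(1)
      int_G1 by (simp add: qscore_def class_integrable_def)
  have 2: "0 \<le> lpm F (fst x) - \<alpha> * fst x - (lpm F (VaR \<alpha> F) - \<alpha> * VaR \<alpha> F)" if "F \<in> \<F>" for F x
    using lpm_minimal[of F \<alpha> "VaR \<alpha> F" "fst x"] is_quantile_VaR[of F \<alpha>] \<F> that a by simp
  have 3: "0 \<le> GG2 (ES \<alpha> F) - GG2 (snd x) - G2 (snd x) * (ES \<alpha> F - snd x)" for F and x :: "real \<times> real"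
    using tangent[of "snd x" "ES \<alpha> F"] by simp
  have nonneg2: "0 \<le> G2 (snd x) / \<alpha> * (lpm F (fst x) - \<alpha> * fst x - (lpm F (VaR \<alpha> F) - \<alpha> * VaR \<alpha> F))"
    if "F \<in> \<F>" for F x
    using 2[OF that] G2_nonneg a by (intro mult_nonneg_nonneg divide_nonneg_pos) auto
  show cons: "consistent \<F> A0 (VaR_ES \<alpha>) S"
    unfolding consistent_def using key 1 nonneg2 3 by (smt (verit))
  assume sm: "strict_mono GG2" and sc: "strictly_convex GG2"
  have G2_pos: "0 < G2 z" for z
    using tangent[of z "z - 1"] strict_monoD[OF sm, of "z - 1" z] by simp
  show "strictly_consistent \<F> A0 (VaR_ES \<alpha>) S"
    unfolding strictly_consistent_def
  proof (intro conjI cons ballI impI)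
    fix F x assume F: "F \<in> \<F>" and x: "x \<in> A0"
      and eq: "expected S (VaR_ES \<alpha> F) F = expected S x F"
    have z: "G2 (snd x) / \<alpha> * (lpm F (fst x) - \<alpha> * fst x - (lpm F (VaR \<alpha> F) - \<alpha> * VaR \<alpha> F)) = 0"
      "GG2 (ES \<alpha> F) - GG2 (snd x) - G2 (snd x) * (ES \<alpha> F - snd x) = 0"
      using key[OF F x] eq 1[OF F, of x] nonneg2[OF F, of x] 3[of F x] by linarith+
    have "fst x = VaR \<alpha> F"
    proof (rule ccontr)
      assume "fst x \<noteq> VaR \<alpha> F"
      then have "lpm F (VaR \<alpha> F) - \<alpha> * VaR \<alpha> F < lpm F (fst x) - \<alpha> * fst x"
        using \<F> F by (intro lpm_strictly_minimal a) auto
      then show False using z(1) G2_pos[of "snd x"] a by simp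
    qed
    moreover have "snd x = ES \<alpha> F"
      using strictly_convex_above_tangent[OF sc GG2[rule_format], of "ES \<alpha> F" "snd x"] z(2) by force
    ultimately show "x = VaR_ES \<alpha> F" by (simp add: prod_eq_iff)
  qed
qed

section \<open>Distributions with continuous densities\<close>

text \<open>For continuous \<open>F\<close> the value of \<open>VaR_ES\<close> is encoded by two
  equations that are affine in \<open>F\<close>. Hence distributions with a prescribed value can be
  built as mixtures.\<close>

lemma VaR_ES_eq_iff:
  assumes F: "distribution_function F" "finite_first_moment F" and a: "0 < \<alpha>" "\<alpha> < 1"
    and uq: "\<exists>!q. is_quantile \<alpha> F q" and cont: "isCont F (fst x)" "isCont F (VaR \<alpha> F)"
  shows "VaR_ES \<alpha> F = x \<longleftrightarrow> F (fst x) = \<alpha> \<and> snd x - fst x + lpm F (fst x) / \<alpha> = 0"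
proof -
  interpret M: real_distribution "interval_measure F"
    by (rule real_distribution_distribution_function[OF F(1)])
  have "VaR \<alpha> F = fst x \<longleftrightarrow> F (fst x) = \<alpha>"
  proof
    have "(F \<longlongrightarrow> F (VaR \<alpha> F)) (at_left (VaR \<alpha> F))"
      using cont(2) by (simp add: isCont_def filterlim_at_split)
    moreover have "eventually (\<lambda>z. F z \<le> \<alpha>) (at_left (VaR \<alpha> F))"
      unfolding eventually_at_left_field
      using VaR_le_iff[OF F(1) a] by (metis less_eq_real_def linorder_not_less lt_ex)
    ultimately have "F (VaR \<alpha> F) \<le> \<alpha>"
      by (intro tendsto_upperbound) auto
    moreover assume "VaR \<alpha> F = fst x"
    ultimately show "F (fst x) = \<alpha>"
      using is_quantile_VaR[OF F(1) a] by (simp add: is_quantile_def)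
  next
    assume eq: "F (fst x) = \<alpha>"
    have "measure (interval_measure F) {..<fst x} \<le> measure (interval_measure F) {..fst x}"
      by (intro M.finite_measure_mono) auto
    then have "is_quantile \<alpha> F (fst x)"
      using eq by (simp add: is_quantile_def measure_atMost_distribution_function[OF F(1)])
    then show "VaR \<alpha> F = fst x"
      using uq is_quantile_VaR[OF F(1) a] by blast
  qed
  then show ?thesis
    using ES_eq_lpm[OF F a] by (auto simp: VaR_ES_def prod_eq_iff)
qed

section \<open>Derivatives of truncated integrals\<close>

lemma has_real_derivative_integral_atMost:
  fixes u f :: "real \<Rightarrow> real"
  assumes f: "continuous_on UNIV f" "\<And>y. 0 \<le> f y" and M: "M = density lborel (\<lambda>y. ennreal (f y))"
    and u: "continuous_on UNIV u" and int: "\<And>x. integrable M (\<lambda>y. indicator {..x} y * u y)"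
  shows "((\<lambda>x. \<integral>y. indicator {..x} y * u y \<partial>M) has_real_derivative u x * f x) (at x)"
proof -
  \<comment> \<open>A base point left of \<open>x\<close> separates the improper part of the
    integral, constant in the upper limit, from an integral over a compact interval, to which the
    fundamental theorem applies.\<close>
  define c where "c = x - 1"
  have [measurable]: "f \<in> borel_measurable borel" "u \<in> borel_measurable borel"
    using f u by (auto intro: borel_measurable_continuous_onI)
  have int': "set_integrable lborel {..z} (\<lambda>y. u y * f y)" for z
  proof -
    have "integrable lborel (\<lambda>y. f y * (indicator {..z} y * u y))"
      using int[of z] f(2) unfolding M by (subst (asm) integrable_real_density) auto
    then show ?thesis by (simp add: set_integrable_def mult_ac)
  qed
  have eq: "(\<integral>y. indicator {..z} y * u y \<partial>M) = (LINT y:{..z}|lborel. u y * f y)" for z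
    using f(2) unfolding M set_lebesgue_integral_def
    by (subst integral_real_density) (auto simp: mult_ac)
  have split: "(\<integral>y. indicator {..z} y * u y \<partial>M) =
      (LINT y:{..<c}|lborel. u y * f y) + integral {c..z} (\<lambda>y. u y * f y)" if "c \<le> z" for z
  proof -
    have i1: "set_integrable lborel {..<c} (\<lambda>y. u y * f y)"
      by (rule set_integrable_subset[OF int'[of z]]) (use that in auto)
    have i2: "set_integrable lborel {c..z} (\<lambda>y. u y * f y)"
      by (rule set_integrable_subset[OF int'[of z]]) auto
    have "{..z} = {..<c} \<union> {c..z}" and disj: "{..<c} \<inter> {c..z} = {}" using that by auto
    then show ?thesis
      using set_integral_Un[OF disj i1 i2] set_borel_integral_eq_integral(2)[OF i2] unfolding eq by auto
  qed
  have "((\<lambda>z. integral {c..z} (\<lambda>y. u y * f y)) has_real_derivative u x * f x) (at x within {c..x+1})"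
    by (rule integral_has_real_derivative)
       (auto intro!: continuous_intros continuous_on_subset[OF u] continuous_on_subset[OF f(1)] simp: c_def)
  then have "((\<lambda>z. integral {c..z} (\<lambda>y. u y * f y)) has_real_derivative u x * f x) (at x)"
    by (subst (asm) at_within_interior) (auto simp: c_def)
  then have "((\<lambda>z. (LINT y:{..<c}|lborel. u y * f y) + integral {c..z} (\<lambda>y. u y * f y))
      has_real_derivative u x * f x) (at x)"
    by (auto intro!: derivative_eq_intros)
  moreover have "eventually (\<lambda>z. c < z) (nhds x)"
    using eventually_nhds_in_open[of "{c<..}" x] by (simp add: c_def)
  then have "eventually (\<lambda>z. (\<integral>y. indicator {..z} y * u y \<partial>M) =
      (LINT y:{..<c}|lborel. u y * f y) + integral {c..z} (\<lambda>y. u y * f y)) (nhds x)"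
    by eventually_elim (simp add: split)
  ultimately show ?thesis
    by (subst DERIV_cong_ev) auto
qed

lemma has_continuous_densityE:
  assumes "has_continuous_density F"
  obtains f where "continuous_on UNIV f" "\<And>y. 0 \<le> f y"
    "interval_measure F = density lborel (\<lambda>y. ennreal (f y))"
  using assms by (auto simp: has_continuous_density_def)

lemma has_real_derivative_distribution_function:
  assumes F: "distribution_function F" and f: "continuous_on UNIV f" "\<And>y. 0 \<le> f y"
    and M: "interval_measure F = density lborel (\<lambda>y. ennreal (f y))"
  shows "(F has_real_derivative f x) (at x)"
proof -
  interpret M: real_distribution "interval_measure F"
    by (rule real_distribution_distribution_function[OF F])
  have "((\<lambda>x. \<integral>y. indicator {..x} y * 1 \<partial>interval_measure F) has_real_derivative 1 * f x) (at x)"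
    by (rule has_real_derivative_integral_atMost[OF f M])
       (auto intro!: integrable_real_indicator simp: M.emeasure_finite less_top[symmetric])
  then show ?thesis
    by (simp add: measure_atMost_distribution_function[OF F])
qed

lemma isCont_distribution_function:
  assumes "distribution_function F" "has_continuous_density F"
  shows "isCont F x"
  using assms by (auto elim!: has_continuous_densityE
      intro: DERIV_isCont has_real_derivative_distribution_function)

text \<open>After writing \<open>lpm F z\<close> as \<open>z * F z\<close> minus the truncated mean,
  the density terms cancel under differentiation and only \<open>F\<close> remains.\<close>

lemma has_real_derivative_lpm:
  assumes F: "distribution_function F" "finite_first_moment F" and dens: "has_continuous_density F"
  shows "(lpm F has_real_derivative F x) (at x)"
proof -
  interpret M: real_distribution "interval_measure F"
    by (rule real_distribution_distribution_function[OF F(1)])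
  obtain f where f: "continuous_on UNIV f" "\<And>y. 0 \<le> f y"
    and M: "interval_measure F = density lborel (\<lambda>y. ennreal (f y))"
    using has_continuous_densityE[OF dens] by metis
  have int: "integrable (interval_measure F) (\<lambda>y. indicator {..x} y * y)" for x
    using integrable_mult_indicator[of "{..x}" "interval_measure F" "\<lambda>y. y"] F(2)
    by (simp add: finite_first_moment_def)
  have ind: "integrable (interval_measure F) (indicator {..x} :: real \<Rightarrow> real)" for x
    by (auto intro!: integrable_real_indicator simp: M.emeasure_finite less_top[symmetric])
  have "lpm F z = z * F z - (\<integral>y. indicator {..z} y * y \<partial>interval_measure F)" for z
  proof -
    have "lpm F z = (\<integral>y. z * indicator {..z} y - indicator {..z} y * y \<partial>interval_measure F)"
      unfolding lpm_def by (intro Bochner_Integration.integral_cong) (auto simp: indicator_def)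
    also have "\<dots> = z * F z - (\<integral>y. indicator {..z} y * y \<partial>interval_measure F)"
      using int ind by (subst Bochner_Integration.integral_diff)
        (auto simp: measure_atMost_distribution_function[OF F(1)])
    finally show ?thesis .
  qed
  moreover have "((\<lambda>z. z * F z - (\<integral>y. indicator {..z} y * y \<partial>interval_measure F))
      has_real_derivative F x) (at x)"
    by (rule derivative_eq_intros has_real_derivative_integral_atMost[OF f M _ int]
        has_real_derivative_distribution_function[OF F(1) f M] continuous_intros refl | simp)+
  ultimately show ?thesis by presburger
qed

section \<open>Mixtures, supports and limits at Dirac measures\<close>

text \<open>Uniqueness of the measure with a given distribution function identifies the mixture with
  the measure \<open>N\<close> of density \<open>(1 - l) * f y + l * g y\<close>, for which the
  integral splits.\<close>

lemma integral_mixture: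
  fixes \<phi> :: "real \<Rightarrow> real"
  assumes F: "distribution_function F" "has_continuous_density F"
    and G: "distribution_function G" "has_continuous_density G"
    and H: "distribution_function (\<lambda>y. (1 - l) * F y + l * G y)" and l: "0 \<le> l" "l \<le> 1"
    and int: "integrable (interval_measure F) \<phi>" "integrable (interval_measure G) \<phi>"
  shows "(\<integral>y. \<phi> y \<partial>interval_measure (\<lambda>y. (1 - l) * F y + l * G y)) =
      (1 - l) * (\<integral>y. \<phi> y \<partial>interval_measure F) + l * (\<integral>y. \<phi> y \<partial>interval_measure G)"
proof -
  obtain f where f: "continuous_on UNIV f" "\<And>y. 0 \<le> f y"
    and MF: "interval_measure F = density lborel (\<lambda>y. ennreal (f y))"
    using has_continuous_densityE[OF F(2)] by metis
  obtain g where g: "continuous_on UNIV g" "\<And>y. 0 \<le> g y"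
    and MG: "interval_measure G = density lborel (\<lambda>y. ennreal (g y))"
    using has_continuous_densityE[OF G(2)] by metis
  have [measurable]: "f \<in> borel_measurable borel" "g \<in> borel_measurable borel"
    using f g by (auto intro: borel_measurable_continuous_onI)
  have [measurable]: "\<phi> \<in> borel_measurable borel"
    using borel_measurable_integrable[OF int(1)] by (simp cong: measurable_cong_sets)
  define h where "h = (\<lambda>y. (1 - l) * f y + l * g y)"
  have h_nonneg: "0 \<le> h y" for y using f g l by (simp add: h_def)
  have [measurable]: "h \<in> borel_measurable borel" by (simp add: h_def)
  define N where "N = density lborel (\<lambda>y. ennreal (h y))"
  have emN: "emeasure N X = ennreal (1 - l) * emeasure (interval_measure F) X
      + ennreal l * emeasure (interval_measure G) X" if [measurable]: "X \<in> sets borel" for X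
    unfolding N_def MF MG h_def using l f g
    by (simp add: emeasure_density ennreal_plus ennreal_mult distrib_right mult.assoc
        nn_integral_add nn_integral_cmult)
  interpret MF: real_distribution "interval_measure F"
    by (rule real_distribution_distribution_function[OF F(1)])
  interpret MG: real_distribution "interval_measure G"
    by (rule real_distribution_distribution_function[OF G(1)])
  have "prob_space N"
  proof
    have "emeasure N UNIV = 1"
      using MF.emeasure_space_1 MG.emeasure_space_1 l
      by (simp add: emN flip: ennreal_plus)
    then show "emeasure N (space N) = 1" by (simp add: N_def)
  qed
  then have N: "real_distribution N"
    by (simp add: real_distribution_def real_distribution_axioms_def N_def)
  have F0: "0 \<le> F x" "0 \<le> G x" for x
    using measure_nonneg measure_atMost_distribution_function[OF F(1)]
      measure_atMost_distribution_function[OF G(1)] by metis+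
  have "cdf N x = (1 - l) * F x + l * G x" for x
  proof -
    have "emeasure N {..x} = ennreal ((1 - l) * F x + l * G x)"
      using l F0[of x] by (simp add: emN MF.emeasure_eq_measure MG.emeasure_eq_measure
        measure_atMost_distribution_function[OF F(1)] measure_atMost_distribution_function[OF G(1)]
        ennreal_plus ennreal_mult)
    then show ?thesis using l F0[of x] by (simp add: cdf_def measure_def del: ennreal_plus)
  qed
  then have eq: "interval_measure (\<lambda>y. (1 - l) * F y + l * G y) = N"
    by (intro cdf_unique real_distribution_distribution_function H N)
       (auto simp: cdf_distribution_function[OF H])
  have i: "integrable lborel (\<lambda>y. f y * \<phi> y)" "integrable lborel (\<lambda>y. g y * \<phi> y)"
    using int f g unfolding MF MG by (simp_all add: integrable_real_density)
  have "(\<integral>y. \<phi> y \<partial>N) = (\<integral>y. (1 - l) * (f y * \<phi> y) + l * (g y * \<phi> y) \<partial>lborel)"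
    unfolding N_def using h_nonneg
    by (subst integral_real_density) (auto simp: h_def algebra_simps)
  also have "\<dots> = (1 - l) * (\<integral>y. \<phi> y \<partial>interval_measure F) + l * (\<integral>y. \<phi> y \<partial>interval_measure G)"
    unfolding MF MG using i f g by (simp add: integral_real_density)
  finally show ?thesis by (simp add: eq)
qed

text \<open>The complement of the support is a union of open null sets, and by the Lindelof property
  countably many of them cover it.\<close>

lemma emeasure_compl_dist_support:
  "emeasure (interval_measure F) (- dist_support F) = 0"
proof -
  define U where "U = {V. open V \<and> emeasure (interval_measure F) V = 0}"
  have eq: "- dist_support F = \<Union>U"
  proof safe
    fix y assume "y \<notin> dist_support F"
    then obtain C where "closed C" "emeasure (interval_measure F) (- C) = 0" "y \<notin> C"
      by (auto simp: dist_support_def)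
    then show "y \<in> \<Union>U" by (auto simp: U_def intro!: exI[of _ "- C"])
  next
    fix y V assume "V \<in> U" "y \<in> V" "y \<in> dist_support F"
    then show False by (auto simp: U_def dist_support_def dest!: spec[of _ "- V"])
  qed
  obtain U' where U': "U' \<subseteq> U" "countable U'" "\<Union>U' = \<Union>U"
    using Lindelof[of U] by (auto simp: U_def)
  have "(\<Union>X\<in>U'. X) \<in> null_sets (interval_measure F)"
    using U' by (intro null_sets_UN') (auto simp: U_def null_sets_def)
  then show ?thesis using eq U'(3) by (auto simp: null_sets_def)
qed

lemma locally_bounded_compact:
  assumes "locally_bounded g" "compact K"
  shows "bounded (g ` K)"
proof -
  obtain U where U: "\<And>y. open (U y)" "\<And>y. y \<in> U y" "\<And>y. bounded (g ` U y)"
    using assms(1) unfolding locally_bounded_def by metis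
  obtain C where "C \<subseteq> K" "finite C" "K \<subseteq> (\<Union>y\<in>C. U y)"
    using compactE_image[OF assms(2), of K U] U by blast
  then have "g ` K \<subseteq> (\<Union>y\<in>C. g ` U y)" by blast
  moreover have "bounded (\<Union>y\<in>C. g ` U y)" using \<open>finite C\<close> U(3) by auto
  ultimately show ?thesis by (rule bounded_subset[rotated])
qed

lemma AE_dist_support:
  assumes "dist_support F \<subseteq> K"
  shows "AE y in interval_measure F. y \<in> K"
proof (rule AE_I)
  show "emeasure (interval_measure F) (- dist_support F) = 0" by (rule emeasure_compl_dist_support)
  show "- dist_support F \<in> sets (interval_measure F)"
  proof -
    have "closed (dist_support F)" unfolding dist_support_def by (rule closed_Inter) auto
    then show ?thesis by auto
  qed
qed (use assms in auto)

lemma integrable_dist_support_compact: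
  fixes \<phi> :: "real \<Rightarrow> real"
  assumes F: "distribution_function F" and K: "compact K" "dist_support F \<subseteq> K"
    and \<phi>: "\<phi> \<in> borel_measurable borel" "locally_bounded \<phi>"
  shows "integrable (interval_measure F) \<phi>"
proof -
  interpret M: real_distribution "interval_measure F"
    by (rule real_distribution_distribution_function[OF F])
  obtain B where B: "\<And>y. y \<in> K \<Longrightarrow> norm (\<phi> y) \<le> B"
    using locally_bounded_compact[OF \<phi>(2) K(1)] by (auto simp: bounded_iff)
  have "AE y in interval_measure F. norm (\<phi> y) \<le> B"
    using AE_dist_support[OF K(2)] by eventually_elim (rule B)
  then show ?thesis using \<phi>(1) by (intro M.integrable_const_bound) auto
qed

text \<open>The common compact support allows replacing the locally bounded \<open>\<phi>\<close> by
  a bounded truncation. Weak convergence then applies although \<open>\<phi>\<close> is continuous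
  only at \<open>y\<close>, since the limit measure charges no other point.\<close>

lemma integral_tendsto_dirac:
  fixes \<phi> :: "real \<Rightarrow> real"
  assumes F: "\<And>n. distribution_function (Fn n)"
    and w: "weak_conv_m (\<lambda>n. interval_measure (Fn n)) (return borel y)"
    and K: "compact K" "\<And>n. dist_support (Fn n) \<subseteq> K"
    and \<phi>: "\<phi> \<in> borel_measurable borel" "locally_bounded \<phi>" "isCont \<phi> y"
  shows "(\<lambda>n. \<integral>z. \<phi> z \<partial>interval_measure (Fn n)) \<longlonglongrightarrow> \<phi> y"
proof -
  \<comment> \<open>The strict bound \<open>\<bar>y\<bar> < b\<close> keeps the truncation equal to
    \<open>\<phi>\<close> in a neighbourhood of \<open>y\<close>, so that continuity at
    \<open>y\<close> survives.\<close>
  obtain b where b: "K \<subseteq> {-b..b}" "\<bar>y\<bar> < b"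
  proof -
    obtain c where "\<And>z. z \<in> K \<Longrightarrow> \<bar>z\<bar> \<le> c"
      using compact_imp_bounded[OF K(1)] by (auto simp: bounded_iff)
    then show ?thesis by (intro that[of "max c (\<bar>y\<bar> + 1)"]) force+
  qed
  define \<psi> where "\<psi> = (\<lambda>z. indicator {-b..b} z * \<phi> z)"
  obtain B where B: "\<And>z. z \<in> {-b..b} \<Longrightarrow> norm (\<phi> z) \<le> B"
    using locally_bounded_compact[OF \<phi>(2), of "{-b..b}"]
    unfolding bounded_iff by blast
  have "y \<in> {-b..b}" using b(2) by auto
  from B[OF this] have "0 \<le> B" by simp
  have [measurable]: "\<phi> \<in> borel_measurable borel" by fact
  have [measurable]: "\<psi> \<in> borel_measurable borel" unfolding \<psi>_def by measurable
  have "eventually (\<lambda>z. z \<in> {-b<..<b}) (nhds y)"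
    using b(2) by (intro eventually_nhds_in_open) auto
  then have ev: "eventually (\<lambda>z. \<psi> z = \<phi> z) (nhds y)"
    by eventually_elim (simp add: \<psi>_def)
  have cont: "isCont \<psi> y"
    using isCont_cong[OF ev] \<phi>(3) by simp
  have rd: "real_distribution (return borel y)"
    by (simp add: real_distribution_def real_distribution_axioms_def prob_space_return)
  have disc: "emeasure (return borel y) {z. \<not> isCont \<psi> z} = 0"
    using cont by (subst emeasure_return) (auto simp: indicator_def)
  have "(\<lambda>n. integral\<^sup>L (interval_measure (Fn n)) \<psi>) \<longlonglongrightarrow> integral\<^sup>L (return borel y) \<psi>"
    by (rule weak_conv_imp_bdd_ae_continuous_conv[OF real_distribution_distribution_function[OF F] rd w disc, of B])
       (use B \<open>0 \<le> B\<close> in \<open>auto simp: \<psi>_def indicator_def\<close>)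
  moreover have "integral\<^sup>L (interval_measure (Fn n)) \<psi> = (\<integral>z. \<phi> z \<partial>interval_measure (Fn n))" for n
  proof (rule integral_cong_AE)
    show "AE z in interval_measure (Fn n). \<psi> z = \<phi> z"
      using AE_dist_support[OF K(2)[of n]] by eventually_elim (use b in \<open>auto simp: \<psi>_def\<close>)
  qed (auto cong: measurable_cong_sets)
  moreover have "integral\<^sup>L (return borel y) \<psi> = \<phi> y"
    using eventually_nhds_x_imp_x[OF ev] by (subst integral_return) auto
  ultimately show ?thesis by simp
qed

section \<open>Osband's principle and symmetry of second derivatives\<close>

definition class_affine :: "(real \<Rightarrow> real) set \<Rightarrow> ((real \<Rightarrow> real) \<Rightarrow> real) \<Rightarrow> bool" where
  "class_affine \<F> \<Phi> \<longleftrightarrow>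
     (\<forall>F\<in>\<F>. \<forall>G\<in>\<F>. \<forall>l\<in>{0..1}. \<Phi> (\<lambda>y. (1 - l) * F y + l * G y) = (1 - l) * \<Phi> F + l * \<Phi> G)"

text \<open>The weights are normalised on the left-hand side, so any positive coefficients may be
  used. One mixture \<open>H\<close> serves all affine functionals at once.\<close>

lemma convex_class_pos_combination2:
  assumes \<F>: "convex_class \<F>" and FG: "F \<in> \<F>" "G \<in> \<F>" and c: "0 < c" "0 < d"
  obtains H where "H \<in> \<F>" "\<And>\<Phi>. class_affine \<F> \<Phi> \<Longrightarrow> (c + d) * \<Phi> H = c * \<Phi> F + d * \<Phi> G"
proof
  define l where "l = d / (c + d)"
  have l: "l \<in> {0..1}" "(c + d) * (1 - l) = c" "(c + d) * l = d"
    using c by (auto simp: l_def field_simps)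
  show "(\<lambda>y. (1 - l) * F y + l * G y) \<in> \<F>"
    using \<F> FG l by (auto simp: convex_class_def)
  fix \<Phi> assume "class_affine \<F> \<Phi>"
  then have "\<Phi> (\<lambda>y. (1 - l) * F y + l * G y) = (1 - l) * \<Phi> F + l * \<Phi> G"
    using FG l by (auto simp: class_affine_def)
  then show "(c + d) * \<Phi> (\<lambda>y. (1 - l) * F y + l * G y) = c * \<Phi> F + d * \<Phi> G"
    using l(2,3) by (simp add: distrib_left flip: mult.assoc)
qed

lemma convex_class_pos_combination3:
  assumes \<F>: "convex_class \<F>" and F: "F1 \<in> \<F>" "F2 \<in> \<F>" "F3 \<in> \<F>"
    and c: "0 < c1" "0 < c2" "0 < c3"
  obtains H where "H \<in> \<F>"
    "\<And>\<Phi>. class_affine \<F> \<Phi> \<Longrightarrow> (c1 + c2 + c3) * \<Phi> H = c1 * \<Phi> F1 + c2 * \<Phi> F2 + c3 * \<Phi> F3"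
proof -
  obtain G where G: "G \<in> \<F>" "\<And>\<Phi>. class_affine \<F> \<Phi> \<Longrightarrow> (c1 + c2) * \<Phi> G = c1 * \<Phi> F1 + c2 * \<Phi> F2"
    using convex_class_pos_combination2[OF \<F> F(1,2) c(1,2)] by blast
  have "0 < c1 + c2" using c by simp
  then obtain H where H: "H \<in> \<F>"
    "\<And>\<Phi>. class_affine \<F> \<Phi> \<Longrightarrow> (c1 + c2 + c3) * \<Phi> H = (c1 + c2) * \<Phi> G + c3 * \<Phi> F3"
    using convex_class_pos_combination2[OF \<F> G(1) F(3) _ c(3)] by blast
  show ?thesis by (rule that[OF H(1)]) (simp add: H(2) G(2))
qed

text \<open>Osband's principle in algebraic form. The negative determinants say that the points
  \<open>(v, w)\<close> of \<open>G1\<close>, \<open>G2\<close>, \<open>G3\<close> surround the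
  origin. An affine functional that vanishes whenever \<open>v\<close> and \<open>w\<close> do must
  then be a linear function of \<open>(v, w)\<close>, and Cramer's rule with \<open>G1\<close> and
  \<open>G2\<close> gives its coefficients.\<close>

lemma osband_class_affine:
  fixes v w p :: "(real \<Rightarrow> real) \<Rightarrow> real"
  assumes \<F>: "convex_class \<F>" and aff: "class_affine \<F> v" "class_affine \<F> w" "class_affine \<F> p"
    and zero: "\<And>F. F \<in> \<F> \<Longrightarrow> v F = 0 \<Longrightarrow> w F = 0 \<Longrightarrow> p F = 0"
    and G: "G1 \<in> \<F>" "G2 \<in> \<F>" "G3 \<in> \<F>"
  defines "D \<equiv> \<lambda>F G. v F * w G - w F * v G"
  assumes neg: "D G1 G2 < 0" "D G2 G3 < 0" "D G3 G1 < 0"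
    and F: "F \<in> \<F>"
  shows "D G1 G2 * p F = D F G2 * p G1 + D G1 F * p G2"
proof -
  \<comment> \<open>These are the barycentric coordinates of the origin in the triangle, up to
    scaling.\<close>
  define c1 c2 c3 where c_def: "c1 = - D G2 G3" "c2 = - D G3 G1" "c3 = - D G1 G2"
  have c: "0 < c1" "0 < c2" "0 < c3" using neg by (auto simp: c_def)
  have rel: "c1 * v G1 + c2 * v G2 + c3 * v G3 = 0" "c1 * w G1 + c2 * w G2 + c3 * w G3 = 0"
    unfolding c_def D_def by algebra+
  obtain H where H: "H \<in> \<F>" "\<And>\<Phi>. class_affine \<F> \<Phi> \<Longrightarrow>
      (c1 + c2 + c3) * \<Phi> H = c1 * \<Phi> G1 + c2 * \<Phi> G2 + c3 * \<Phi> G3"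
    using convex_class_pos_combination3[OF \<F> G c] by blast
  have "v H = 0" "w H = 0"
    using H(2)[OF aff(1)] H(2)[OF aff(2)] rel c by auto
  then have "p H = 0" by (rule zero[OF H(1)])
  then have relp: "c1 * p G1 + c2 * p G2 + c3 * p G3 = 0"
    using H(2)[OF aff(3)] by simp
  \<comment> \<open>Adding \<open>N\<close> times the barycentric relation leaves all values
    unchanged where that relation holds, and \<open>N\<close> is large enough to make the possibly
    negative Cramer coefficients positive. \<open>F\<close> can thus be mixed into a distribution
    \<open>L\<close> with \<open>v L = 0\<close> and \<open>w L = 0\<close>.\<close>
  define N where "N = 1 + \<bar>D F G2\<bar> / c1 + \<bar>D G1 F\<bar> / c2"
  define d1 d2 d3 where d_def: "d1 = D F G2 + N * c1" "d2 = D G1 F + N * c2" "d3 = N * c3"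
  have "N * c1 = c1 + \<bar>D F G2\<bar> + c1 * (\<bar>D G1 F\<bar> / c2)"
    "N * c2 = c2 + c2 * (\<bar>D F G2\<bar> / c1) + \<bar>D G1 F\<bar>"
    using c by (auto simp: N_def distrib_right)
  moreover have "0 \<le> c1 * (\<bar>D G1 F\<bar> / c2)" "0 \<le> c2 * (\<bar>D F G2\<bar> / c1)" "0 < N"
    using c by (auto simp: N_def intro!: add_pos_nonneg)
  ultimately have d: "0 < d1" "0 < d2" "0 < d3"
    using c unfolding d_def by (linarith, linarith, simp)
  obtain K where K: "K \<in> \<F>" "\<And>\<Phi>. class_affine \<F> \<Phi> \<Longrightarrow>
      (d1 + d2 + d3) * \<Phi> K = d1 * \<Phi> G1 + d2 * \<Phi> G2 + d3 * \<Phi> G3"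
    using convex_class_pos_combination3[OF \<F> G d] by blast
  have "0 < d1 + d2 + d3" using d by simp
  then obtain L where L: "L \<in> \<F>" "\<And>\<Phi>. class_affine \<F> \<Phi> \<Longrightarrow>
      (c3 + (d1 + d2 + d3)) * \<Phi> L = c3 * \<Phi> F + (d1 + d2 + d3) * \<Phi> K"
    using convex_class_pos_combination2[OF \<F> F K(1) c(3)] by blast
  have L': "(c3 + (d1 + d2 + d3)) * \<Phi> L =
      c3 * \<Phi> F + D F G2 * \<Phi> G1 + D G1 F * \<Phi> G2 + N * (c1 * \<Phi> G1 + c2 * \<Phi> G2 + c3 * \<Phi> G3)"
    if "class_affine \<F> \<Phi>" for \<Phi>
    unfolding L(2)[OF that] K(2)[OF that] by (simp add: d_def algebra_simps)
  have cramer: "c3 * v F + D F G2 * v G1 + D G1 F * v G2 = 0"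
    "c3 * w F + D F G2 * w G1 + D G1 F * w G2 = 0"
    unfolding c_def D_def by algebra+
  have "v L = 0" "w L = 0"
    using L'[OF aff(1)] L'[OF aff(2)] cramer rel c d by auto
  then have "p L = 0" by (rule zero[OF L(1)])
  then show ?thesis
    using L'[OF aff(3)] relp by (simp add: c_def)
qed

section \<open>Products at a zero and mixed second derivatives\<close>

text \<open>A product rule in which \<open>h\<close> is merely continuous: \<open>v\<close> vanishes
  at the point, so its Caratheodory slope absorbs the factor \<open>h\<close>.\<close>

lemma has_real_derivative_mult_zero:
  fixes h v :: "real \<Rightarrow> real"
  assumes "isCont h a" "v a = 0" "(v has_real_derivative d) (at a)"
  shows "((\<lambda>s. h s * v s) has_real_derivative h a * d) (at a)"
proof -
  obtain g where g: "\<And>z. v z - v a = g z * (z - a)" "isCont g a" "g a = d"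
    using assms(3) unfolding CARAT_DERIV by blast
  show ?thesis
    unfolding CARAT_DERIV
    using g assms(1,2) by (intro exI[of _ "\<lambda>z. h z * g z"]) (auto intro: isCont_mult)
qed

text \<open>The mean value theorem in the first variable expresses the second difference over a
  square through two values of \<open>p\<close>. Differentiability of \<open>p\<close> at the corner
  \<open>t\<close> then gives the leading term with an error of order
  \<open>e * (s * s)\<close>.\<close>

lemma mixed_second_difference:
  fixes f p :: "real \<times> real \<Rightarrow> real"
  assumes r: "0 < r" and p: "\<And>x. dist x t < r \<Longrightarrow> ((\<lambda>s. f (s, snd x)) has_real_derivative p x) (at (fst x))"
    and p': "(p has_derivative p') (at t)" and e: "0 < e"
  obtains d where "0 < d" "\<And>s. 0 < s \<Longrightarrow> s < d \<Longrightarrow>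
    \<bar>f (fst t + s, snd t + s) - f (fst t + s, snd t) - f (fst t, snd t + s) + f t - s * s * p' (0, 1)\<bar>
      \<le> e * (s * s)"
proof -
  obtain d0 where d0: "0 < d0" "\<And>y. norm (y - t) < d0 \<Longrightarrow>
      \<bar>p y - p t - p' (y - t)\<bar> \<le> e / 3 * norm (y - t)"
    using p' e unfolding has_derivative_at_alt by (metis real_norm_def zero_less_divide_iff zero_less_numeral)
  have lin: "linear p'" using p' has_derivative_linear by blast
  \<comment> \<open>The points of the square are within distance \<open>2 * s\<close> of
    \<open>t\<close>, whence the factor one half.\<close>
  define d where "d = min r d0 / 2"
  show ?thesis
  proof (rule that[of d])
    show "0 < d" using r d0 by (simp add: d_def)
    fix s :: real assume s: "0 < s" "s < d"
    have nrm: "norm (u, v) \<le> \<bar>u\<bar> + \<bar>v\<bar>" for u v :: real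
      using norm_Pair_le[of u v] by simp
    define \<phi> where "\<phi> = (\<lambda>u. f (u, snd t + s) - f (u, snd t))"
    have "\<exists>z. fst t < z \<and> z < fst t + s \<and> \<phi> (fst t + s) - \<phi> (fst t) =
        (fst t + s - fst t) * (p (z, snd t + s) - p (z, snd t))"
    proof (rule MVT2)
      fix u assume u: "fst t \<le> u" "u \<le> fst t + s"
      have "dist (u, snd t + s') t < r" if "0 \<le> s'" "s' \<le> s" for s'
      proof -
        have "dist (u, snd t + s') t = norm (u - fst t, s')"
          by (cases t) (simp add: dist_norm)
        also have "\<dots> \<le> \<bar>u - fst t\<bar> + \<bar>s'\<bar>" by (rule nrm)
        also have "\<dots> < r" using u s that by (simp add: d_def)
        finally show ?thesis .
      qed
      from p[OF this[of s]] p[OF this[of 0]] s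
      show "(\<phi> has_real_derivative p (u, snd t + s) - p (u, snd t)) (at u)"
        unfolding \<phi>_def by (auto intro!: derivative_eq_intros)
    qed (use s in auto)
    then obtain z where z: "fst t < z" "z < fst t + s"
      "\<phi> (fst t + s) - \<phi> (fst t) = s * (p (z, snd t + s) - p (z, snd t))" by auto
    define A B where "A = p (z, snd t + s) - p t - p' (z - fst t, s)"
      and "B = p (z, snd t) - p t - p' (z - fst t, 0)"
    have nA: "norm (z - fst t, s) \<le> 2 * s" and nB: "norm (z - fst t, 0 :: real) \<le> s"
      using nrm[of "z - fst t" s] nrm[of "z - fst t" 0] z s by auto
    have "\<bar>A\<bar> \<le> e / 3 * norm (z - fst t, s)"
      using d0(2)[of "(z, snd t + s)"] nA s by (cases t) (simp add: A_def d_def)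
    also have "\<dots> \<le> e / 3 * (2 * s)" using e nA by (intro mult_left_mono) auto
    finally have A: "\<bar>A\<bar> \<le> e / 3 * (2 * s)" .
    have "\<bar>B\<bar> \<le> e / 3 * norm (z - fst t, 0 :: real)"
      using d0(2)[of "(z, snd t)"] nB s by (cases t) (simp add: B_def d_def)
    also have "\<dots> \<le> e / 3 * s" using e nB by (intro mult_left_mono) auto
    finally have B: "\<bar>B\<bar> \<le> e / 3 * s" .
    have "p' (z - fst t, s) - p' (z - fst t, 0) = s * p' (0, 1)"
      using linear_diff[OF lin, of "(z - fst t, s)" "(z - fst t, 0)"] linear_scale[OF lin, of s "(0, 1)"]
      by simp
    then have "\<phi> (fst t + s) - \<phi> (fst t) - s * s * p' (0, 1) = s * (A - B)"
      unfolding z(3) A_def B_def by (simp add: algebra_simps)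
    also have "\<bar>\<dots>\<bar> \<le> s * (e * s)"
      using A B s by (auto simp: abs_mult intro!: mult_left_mono)
    finally show "\<bar>f (fst t + s, snd t + s) - f (fst t + s, snd t) - f (fst t, snd t + s) + f t - s * s * p' (0, 1)\<bar>
      \<le> e * (s * s)"
      by (simp add: \<phi>_def algebra_simps)
  qed
qed

text \<open>The second difference over a square is invariant under exchanging the coordinates, so
  the same quantity is approximated by both mixed derivatives times \<open>s * s\<close>.\<close>

lemma mixed_partial_derivatives_eq:
  fixes f p q :: "real \<times> real \<Rightarrow> real"
  assumes r: "0 < r"
    and p: "\<And>x. dist x t < r \<Longrightarrow> ((\<lambda>s. f (s, snd x)) has_real_derivative p x) (at (fst x))"
    and q: "\<And>x. dist x t < r \<Longrightarrow> ((\<lambda>s. f (fst x, s)) has_real_derivative q x) (at (snd x))"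
    and p': "(p has_derivative p') (at t)" and q': "(q has_derivative q') (at t)"
  shows "p' (0, 1) = q' (1, 0)"
proof -
  have swap: "dist (prod.swap x) t < r" if "dist x (prod.swap t) < r" for x
    using that by (cases x; cases t) (simp add: dist_Pair_Pair add.commute)
  have q'': "((\<lambda>x. q (prod.swap x)) has_derivative (\<lambda>h. q' (prod.swap h))) (at (prod.swap t))"
    by (rule has_derivative_compose[of prod.swap prod.swap, where g = q])
       (auto simp: q' prod.swap_def[abs_def] intro!: derivative_eq_intros)
  have "\<bar>p' (0, 1) - q' (1, 0)\<bar> \<le> e" if e: "0 < e" for e
  proof -
    have "0 < e / 2" using e by simp
    obtain d where d: "0 < d" "\<And>s. 0 < s \<Longrightarrow> s < d \<Longrightarrow>
      \<bar>f (fst t + s, snd t + s) - f (fst t + s, snd t) - f (fst t, snd t + s) + f t - s * s * p' (0, 1)\<bar>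
        \<le> e / 2 * (s * s)"
      using mixed_second_difference[OF r p p' \<open>0 < e / 2\<close>] by blast
    obtain d' where d': "0 < d'" "\<And>s. 0 < s \<Longrightarrow> s < d' \<Longrightarrow>
      \<bar>f (fst t + s, snd t + s) - f (fst t, snd t + s) - f (fst t + s, snd t) + f t - s * s * q' (1, 0)\<bar>
        \<le> e / 2 * (s * s)"
      using mixed_second_difference[OF r, of "prod.swap t" "\<lambda>x. f (prod.swap x)" "\<lambda>x. q (prod.swap x)",
          OF _ q'' \<open>0 < e / 2\<close>] q[OF swap] by auto
    define s where "s = min d d' / 2"
    have s: "0 < s" "s < d" "s < d'" using d(1) d'(1) by (auto simp: s_def)
    have "\<bar>s * s * p' (0, 1) - s * s * q' (1, 0)\<bar> \<le> e * (s * s)"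
      using d(2)[OF s(1,2)] d'(2)[OF s(1,3)] by linarith
    also have "s * s * p' (0, 1) - s * s * q' (1, 0) = (s * s) * (p' (0, 1) - q' (1, 0))"
      by (simp add: algebra_simps)
    finally show ?thesis using s(1) by (simp add: abs_mult mult.commute)
  qed
  then have "\<bar>p' (0, 1) - q' (1, 0)\<bar> \<le> 0" by (rule field_le_epsilon[of _ 0, simplified])
  then show ?thesis by simp
qed

text \<open>The components of the gradient are the partial derivatives. At \<open>t\<close> both are
  differentiable, so the symmetry of mixed derivatives applies to them.\<close>

lemma score_smooth_partials:
  assumes "score_smooth U t f" and U: "open U"
  obtains p q where "continuous_on U p" "continuous_on U q"
    "\<And>x. x \<in> U \<Longrightarrow> ((\<lambda>s. f (s, snd x)) has_real_derivative p x) (at (fst x))"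
    "\<And>x. x \<in> U \<Longrightarrow> ((\<lambda>s. f (fst x, s)) has_real_derivative q x) (at (snd x))"
    "t \<in> U \<Longrightarrow> \<exists>p' q'. (p has_derivative p') (at t) \<and> (q has_derivative q') (at t) \<and> p' (0, 1) = q' (1, 0)"
proof -
  obtain g where g: "\<And>x. x \<in> U \<Longrightarrow> GDERIV f x :> g x" "continuous_on U g"
    and tU: "t \<in> U \<Longrightarrow> \<exists>H N. t \<in> N \<and> (\<forall>x\<in>N. (g has_derivative blinfun_apply (H x)) (at x))"
    using assms(1) unfolding score_smooth_def by blast
  have p: "((\<lambda>s. f (s, snd x)) has_real_derivative fst (g x)) (at (fst x))" if "x \<in> U" for x
  proof -
    have "((\<lambda>s. f (s, snd x)) has_derivative (\<lambda>h. inner (h, 0) (g x))) (at (fst x))"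
      by (rule has_derivative_compose[of "\<lambda>s. (s, snd x)" _ _ _ f])
         (use g(1)[OF that] in \<open>auto simp: gderiv_def intro!: derivative_eq_intros\<close>)
    then show ?thesis
      by (simp add: has_field_derivative_def inner_prod_def mult.commute[of _ "fst (g x)"] cong: if_cong)
  qed
  have q: "((\<lambda>s. f (fst x, s)) has_real_derivative snd (g x)) (at (snd x))" if "x \<in> U" for x
  proof -
    have "((\<lambda>s. f (fst x, s)) has_derivative (\<lambda>h. inner (0, h) (g x))) (at (snd x))"
      by (rule has_derivative_compose[of "\<lambda>s. (fst x, s)" _ _ _ f])
         (use g(1)[OF that] in \<open>auto simp: gderiv_def intro!: derivative_eq_intros\<close>)
    then show ?thesis
      by (simp add: has_field_derivative_def inner_prod_def mult.commute[of _ "snd (g x)"] cong: if_cong)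
  qed
  show ?thesis
  proof (rule that[OF _ _ p q])
    assume t: "t \<in> U"
    obtain r where r: "0 < r" "ball t r \<subseteq> U" using U t by (meson openE)
    obtain H where H: "(g has_derivative blinfun_apply H) (at t)" using tU[OF t] by blast
    have D: "((\<lambda>x. fst (g x)) has_derivative (\<lambda>h. fst (blinfun_apply H h))) (at t)"
      "((\<lambda>x. snd (g x)) has_derivative (\<lambda>h. snd (blinfun_apply H h))) (at t)"
      using H by (auto intro!: derivative_eq_intros)
    have "fst (blinfun_apply H (0, 1)) = snd (blinfun_apply H (1, 0))"
      by (rule mixed_partial_derivatives_eq[OF r(1) p q D])
         (use r(2) in \<open>auto simp: dist_commute\<close>)
    then show "\<exists>p' q'. ((\<lambda>x. fst (g x)) has_derivative p') (at t) \<and>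
        ((\<lambda>x. snd (g x)) has_derivative q') (at t) \<and> p' (0, 1) = q' (1, 0)"
      using D by blast
  qed (use g(2) in \<open>auto intro!: continuous_intros\<close>)
qed

section \<open>The action domain\<close>

lemma continuous_imp_locally_bounded:
  fixes g :: "real \<Rightarrow> real"
  assumes "continuous_on UNIV g"
  shows "locally_bounded g"
  unfolding locally_bounded_def
proof
  fix y
  have "compact (g ` cball y 1)"
    by (intro compact_continuous_image continuous_on_subset[OF assms]) auto
  then have "bounded (g ` ball y 1)"
    using compact_imp_bounded bounded_subset by (metis ball_subset_cball image_mono)
  then show "\<exists>U. open U \<and> y \<in> U \<and> bounded (g ` U)"
    by (intro exI[of _ "ball y 1"]) auto
qed

lemma fst_integral_Pair:
  fixes f :: "'a \<Rightarrow> real" and g :: "'a \<Rightarrow> real"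
  assumes "integrable M f" "integrable M g"
  shows "fst (\<integral>x. (f x, g x) \<partial>M) = (\<integral>x. f x \<partial>M)"
proof -
  have "integrable M (\<lambda>x. (f x, 0) + (0, g x))"
    by (intro Bochner_Integration.integrable_add
        integrable_bounded_linear[OF bounded_linear_Pair[OF bounded_linear_ident bounded_linear_zero] assms(1)]
        integrable_bounded_linear[OF bounded_linear_Pair[OF bounded_linear_zero bounded_linear_ident] assms(2)])
  then have "integrable M (\<lambda>x. (f x, g x))" by simp
  from integral_bounded_linear[OF bounded_linear_fst this] show ?thesis by simp
qed

locale var_es_class =
  fixes \<alpha> :: real and \<F> :: "(real \<Rightarrow> real) set"
  assumes \<alpha>: "0 < \<alpha>" "\<alpha> < 1"
    and \<F>: "\<forall>F\<in>\<F>. distribution_function F \<and> finite_first_moment F \<and> (\<exists>!q. is_quantile \<alpha> F q)"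
    and density: "\<forall>F\<in>\<F>. has_continuous_density F"
    and convex: "convex_class \<F>"
    and dirac: "\<forall>y. \<exists>Fn :: nat \<Rightarrow> real \<Rightarrow> real.
           (\<forall>n. Fn n \<in> \<F>) \<and>
           weak_conv_m (\<lambda>n. interval_measure (Fn n)) (return borel y) \<and>
           (\<exists>K. compact K \<and> (\<forall>n. dist_support (Fn n) \<subseteq> K))"
begin

definition U :: "(real \<times> real) set" where "U = {x. snd x < fst x}"

definition V :: "(real \<Rightarrow> real) \<Rightarrow> real \<times> real \<Rightarrow> real" where "V F x = F (fst x) - \<alpha>"

text \<open>The expected second component of \<open>ident_V\<close> plus
  \<open>fst x / \<alpha>\<close> times the expected first. This combination has the same zeros
  jointly with \<open>V\<close>, and its derivative in the first coordinate is
  \<open>V F x / \<alpha>\<close>, which vanishes at \<open>VaR_ES \<alpha> F\<close>.\<close>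

definition W :: "(real \<Rightarrow> real) \<Rightarrow> real \<times> real \<Rightarrow> real" where
  "W F x = snd x - fst x + lpm F (fst x) / \<alpha>"

text \<open>The determinant of the vectors \<open>(V, W)\<close> of two distributions; three such
  signs locate the origin relative to a triangle.\<close>

definition VW :: "(real \<Rightarrow> real) \<Rightarrow> (real \<Rightarrow> real) \<Rightarrow> real \<times> real \<Rightarrow> real" where
  "VW F G x = V F x * W G x - W F x * V G x"

lemma open_U: "open U"
  unfolding U_def by (intro open_Collect_less continuous_intros)

lemma in_class:
  assumes "F \<in> \<F>"
  shows "distribution_function F" "finite_first_moment F" "\<exists>!q. is_quantile \<alpha> F q"
    "has_continuous_density F"
  using assms \<F> density by auto

lemma VaR_ES_eq_iff_VW:
  assumes "F \<in> \<F>"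
  shows "VaR_ES \<alpha> F = x \<longleftrightarrow> V F x = 0 \<and> W F x = 0"
  using VaR_ES_eq_iff[OF in_class(1,2)[OF assms] \<alpha> in_class(3)[OF assms]]
    isCont_distribution_function[OF in_class(1,4)[OF assms]]
  by (simp add: V_def W_def)

lemma class_affine_integral:
  assumes "class_integrable \<F> h"
  shows "class_affine \<F> (\<lambda>F. \<integral>y. h y \<partial>interval_measure F)"
  unfolding class_affine_def
proof (intro ballI)
  fix F G l assume *: "F \<in> \<F>" "G \<in> \<F>" "l \<in> {0..1::real}"
  then have "(\<lambda>y. (1 - l) * F y + l * G y) \<in> \<F>"
    using convex by (auto simp: convex_class_def)
  then show "(\<integral>y. h y \<partial>interval_measure (\<lambda>y. (1 - l) * F y + l * G y)) =
      (1 - l) * (\<integral>y. h y \<partial>interval_measure F) + l * (\<integral>y. h y \<partial>interval_measure G)"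
    using * assms by (intro integral_mixture) (auto simp: class_integrable_def in_class)
qed

lemma class_affine_V: "class_affine \<F> (\<lambda>F. V F x)"
  by (auto simp: class_affine_def V_def algebra_simps)

lemma class_affine_W: "class_affine \<F> (\<lambda>F. W F x)"
proof -
  have aff: "class_affine \<F> (\<lambda>F. lpm F (fst x))"
    unfolding lpm_def
    by (intro class_affine_integral) (simp add: class_integrable_def integrable_lpm in_class)
  show ?thesis
    unfolding class_affine_def
  proof (intro ballI)
    fix F G l assume "F \<in> \<F>" "G \<in> \<F>" "l \<in> {0..1::real}"
    then have "lpm (\<lambda>y. (1 - l) * F y + l * G y) (fst x) = (1 - l) * lpm F (fst x) + l * lpm G (fst x)"
      using aff unfolding class_affine_def by blast
    then show "W (\<lambda>y. (1 - l) * F y + l * G y) x = (1 - l) * W F x + l * W G x"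
      unfolding W_def by (simp only:) (simp add: algebra_simps add_divide_distrib diff_divide_distrib)
  qed
qed

lemma has_real_derivative_V:
  assumes "F \<in> \<F>"
  obtains d where "\<And>v. ((\<lambda>s. V F (s, v)) has_real_derivative d u) (at u)"
proof -
  obtain f where "continuous_on UNIV f" "\<And>y. 0 \<le> f y"
    "interval_measure F = density lborel (\<lambda>y. ennreal (f y))"
    using has_continuous_densityE[OF in_class(4)[OF assms]] by metis
  then have "(F has_real_derivative f u) (at u)"
    by (rule has_real_derivative_distribution_function[OF in_class(1)[OF assms]])
  then show ?thesis
    by (intro that[of "\<lambda>u. f u"]) (auto simp: V_def intro!: derivative_eq_intros)
qed

lemma has_real_derivative_W_fst:
  assumes "F \<in> \<F>"
  shows "((\<lambda>s. W F (s, v)) has_real_derivative V F (u, v) / \<alpha>) (at u)"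
  unfolding W_def V_def fst_conv snd_conv
  using has_real_derivative_lpm[OF in_class(1,2,4)[OF assms], of u] \<alpha>
  by (auto intro!: derivative_eq_intros simp: field_simps)

lemma has_real_derivative_W_snd: "((\<lambda>s. W F (u, s)) has_real_derivative 1) (at v)"
  by (auto simp: W_def intro!: derivative_eq_intros)

lemma continuous_on_V: "F \<in> \<F> \<Longrightarrow> continuous_on X (V F)"
  unfolding V_def
  by (intro continuous_intros continuous_on_compose2[of UNIV F X fst])
     (auto intro!: continuous_at_imp_continuous_on isCont_distribution_function in_class)

lemma continuous_on_W: "F \<in> \<F> \<Longrightarrow> continuous_on X (W F)"
  unfolding W_def
  by (intro continuous_intros continuous_on_compose2[of UNIV "lpm F" X fst])
     (use \<alpha> in \<open>auto intro!: continuous_at_imp_continuous_on DERIV_isCont has_real_derivative_lpm in_class\<close>)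

section \<open>Dirac approximations inside the class\<close>

definition approaches_dirac :: "(nat \<Rightarrow> real \<Rightarrow> real) \<Rightarrow> real \<Rightarrow> bool" where
  "approaches_dirac Fn y \<longleftrightarrow> (\<forall>n. Fn n \<in> \<F>) \<and>
     weak_conv_m (\<lambda>n. interval_measure (Fn n)) (return borel y) \<and>
     (\<exists>K. compact K \<and> (\<forall>n. dist_support (Fn n) \<subseteq> K))"

lemma ex_approaches_dirac: "\<exists>Fn. approaches_dirac Fn y"
  using dirac by (auto simp: approaches_dirac_def)

lemma approaches_dirac_in_class: "approaches_dirac Fn y \<Longrightarrow> Fn n \<in> \<F>"
  by (simp add: approaches_dirac_def)

lemma approaches_dirac_integral:
  fixes \<phi> :: "real \<Rightarrow> real"
  assumes Fn: "approaches_dirac Fn y" and \<phi>: "\<phi> \<in> borel_measurable borel" "locally_bounded \<phi>"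
  shows "isCont \<phi> y \<Longrightarrow> (\<lambda>n. \<integral>z. \<phi> z \<partial>interval_measure (Fn n)) \<longlonglongrightarrow> \<phi> y"
    and "integrable (interval_measure (Fn n)) \<phi>"
proof -
  note F = in_class(1)[OF approaches_dirac_in_class[OF Fn]]
  obtain K where w: "weak_conv_m (\<lambda>n. interval_measure (Fn n)) (return borel y)"
    and K: "compact K" "\<And>n. dist_support (Fn n) \<subseteq> K"
    using Fn by (auto simp: approaches_dirac_def)
  show "isCont \<phi> y \<Longrightarrow> (\<lambda>n. \<integral>z. \<phi> z \<partial>interval_measure (Fn n)) \<longlonglongrightarrow> \<phi> y"
    by (rule integral_tendsto_dirac[OF F w K \<phi>])
  show "integrable (interval_measure (Fn n)) \<phi>"
    by (rule integrable_dist_support_compact[OF F K \<phi>])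
qed

text \<open>\<open>Fn n s\<close> is the mean of the indicator of \<open>{..s}\<close>, which is
  continuous at \<open>y\<close> exactly because \<open>s\<close> differs from
  \<open>y\<close>.\<close>

lemma approaches_dirac_cdf:
  assumes Fn: "approaches_dirac Fn y" and "s \<noteq> y"
  shows "(\<lambda>n. Fn n s) \<longlonglongrightarrow> indicator {y..} s"
proof -
  have "locally_bounded (indicator {..s} :: real \<Rightarrow> real)"
    unfolding locally_bounded_def
    by (intro allI exI[of _ UNIV]) (auto intro!: boundedI[of _ 1] simp: indicator_def)
  moreover have "isCont (indicator {..s} :: real \<Rightarrow> real) y"
    using \<open>s \<noteq> y\<close> by (auto simp: isCont_indicator frontier_real_atMost)
  ultimately have "(\<lambda>n. \<integral>z. indicator {..s} z \<partial>interval_measure (Fn n)) \<longlonglongrightarrow> (indicator {..s} y :: real)"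
    by (intro approaches_dirac_integral(1)[OF Fn]) auto
  moreover have "(indicator {..s} y :: real) = indicator {y..} s"
    by (simp add: indicator_def)
  ultimately show ?thesis
    by (simp add: measure_atMost_distribution_function[OF in_class(1)[OF approaches_dirac_in_class[OF Fn]]])
qed

lemma approaches_dirac_lpm:
  assumes Fn: "approaches_dirac Fn y"
  shows "(\<lambda>n. lpm (Fn n) s) \<longlonglongrightarrow> max 0 (s - y)"
  unfolding lpm_def
  by (intro approaches_dirac_integral(1)[OF Fn] continuous_imp_locally_bounded)
     (auto intro!: continuous_intros)

lemma approaches_dirac_VW:
  assumes Fn: "approaches_dirac Fn y"
  shows "fst x \<noteq> y \<Longrightarrow> (\<lambda>n. V (Fn n) x) \<longlonglongrightarrow> indicator {y..} (fst x) - \<alpha>"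
    and "(\<lambda>n. W (Fn n) x) \<longlonglongrightarrow> snd x - fst x + max 0 (fst x - y) / \<alpha>"
  unfolding V_def W_def using \<alpha>
  by (auto intro!: tendsto_intros approaches_dirac_cdf[OF Fn] approaches_dirac_lpm[OF Fn])

lemma VW_triple:
  assumes x: "x \<in> U"
  obtains G1 G2 G3 where "G1 \<in> \<F>" "G2 \<in> \<F>" "G3 \<in> \<F>"
    "VW G1 G2 x < 0" "VW G2 G3 x < 0" "VW G3 G1 x < 0"
proof -
  \<comment> \<open>With \<open>y1\<close> and \<open>y2\<close> left of \<open>fst x\<close> and
    \<open>y3\<close> right of it, the limits of the three determinants are
    \<open>(1 - \<alpha>) * ((y1 - y2) / \<alpha>)\<close>, \<open>snd x - y2\<close> and
    \<open>y1 - snd x\<close>. They are negative as soon as \<open>snd x\<close> lies strictly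
    between \<open>y1\<close> and \<open>y2\<close>.\<close>
  define y1 y2 y3 where y: "y1 = snd x - 1" "y2 = (snd x + fst x) / 2" "y3 = fst x + 1"
  have ord: "y1 < snd x" "snd x < y2" "y2 < fst x" "fst x < y3" using x by (auto simp: y U_def)
  obtain F1 F2 F3 where F: "approaches_dirac F1 y1" "approaches_dirac F2 y2" "approaches_dirac F3 y3"
    using ex_approaches_dirac by metis
  have F1: "(\<lambda>n. V (F1 n) x) \<longlonglongrightarrow> 1 - \<alpha>"
    "(\<lambda>n. W (F1 n) x) \<longlonglongrightarrow> snd x - fst x + (fst x - y1) / \<alpha>"
    using approaches_dirac_VW[OF F(1), of x] ord by (simp_all add: max_def)
  have F2: "(\<lambda>n. V (F2 n) x) \<longlonglongrightarrow> 1 - \<alpha>"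
    "(\<lambda>n. W (F2 n) x) \<longlonglongrightarrow> snd x - fst x + (fst x - y2) / \<alpha>"
    using approaches_dirac_VW[OF F(2), of x] ord by (simp_all add: max_def)
  have F3: "(\<lambda>n. V (F3 n) x) \<longlonglongrightarrow> - \<alpha>"
    "(\<lambda>n. W (F3 n) x) \<longlonglongrightarrow> snd x - fst x"
    using approaches_dirac_VW[OF F(3), of x] ord by (simp_all add: max_def)
  have l12: "(\<lambda>n. VW (F1 n) (F2 n) x) \<longlonglongrightarrow> (1 - \<alpha>) * ((y1 - y2) / \<alpha>)"
    unfolding VW_def
    by (rule tendsto_eq_rhs[OF tendsto_diff[OF tendsto_mult[OF F1(1) F2(2)] tendsto_mult[OF F1(2) F2(1)]]])
       (use \<alpha> in \<open>simp add: field_simps\<close>)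
  have l23: "(\<lambda>n. VW (F2 n) (F3 n) x) \<longlonglongrightarrow> snd x - y2"
    unfolding VW_def
    by (rule tendsto_eq_rhs[OF tendsto_diff[OF tendsto_mult[OF F2(1) F3(2)] tendsto_mult[OF F2(2) F3(1)]]])
       (use \<alpha> in \<open>simp add: field_simps\<close>)
  have l31: "(\<lambda>n. VW (F3 n) (F1 n) x) \<longlonglongrightarrow> y1 - snd x"
    unfolding VW_def
    by (rule tendsto_eq_rhs[OF tendsto_diff[OF tendsto_mult[OF F3(1) F1(2)] tendsto_mult[OF F3(2) F1(1)]]])
       (use \<alpha> in \<open>simp add: field_simps\<close>)
  have "(1 - \<alpha>) * ((y1 - y2) / \<alpha>) < 0"
    using ord \<alpha> by (intro mult_pos_neg divide_neg_pos) auto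
  then have "\<forall>\<^sub>F n in sequentially. VW (F1 n) (F2 n) x < 0 \<and> VW (F2 n) (F3 n) x < 0 \<and> VW (F3 n) (F1 n) x < 0"
    using ord by (intro eventually_conj order_tendstoD(2)[OF l12] order_tendstoD(2)[OF l23]
        order_tendstoD(2)[OF l31]) auto
  then obtain n where "VW (F1 n) (F2 n) x < 0" "VW (F2 n) (F3 n) x < 0" "VW (F3 n) (F1 n) x < 0"
    using eventually_happens'[OF sequentially_bot] by blast
  then show ?thesis using F[THEN approaches_dirac_in_class] that by blast
qed

lemma image_VaR_ES: "VaR_ES \<alpha> ` \<F> = U"
proof (intro equalityI image_subsetI subsetI)
  fix F assume F: "F \<in> \<F>"
  have VW: "V F (VaR_ES \<alpha> F) = 0" "W F (VaR_ES \<alpha> F) = 0"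
    using VaR_ES_eq_iff_VW[OF F, of "VaR_ES \<alpha> F"] by auto
  \<comment> \<open>A zero of the nonnegative \<open>lpm F\<close> is a minimum, so its derivative
    \<open>F\<close> would vanish there, while \<open>F (VaR \<alpha> F) = \<alpha>\<close>.\<close>
  have "lpm F (VaR \<alpha> F) \<noteq> 0"
  proof
    assume "lpm F (VaR \<alpha> F) = 0"
    then have "F (VaR \<alpha> F) = 0"
      by (intro DERIV_local_min[OF has_real_derivative_lpm[OF in_class(1,2,4)[OF F]], of 1])
         (auto simp: lpm_nonneg)
    then show False using VW(1) \<alpha> by (simp add: V_def)
  qed
  then have "0 < lpm F (VaR \<alpha> F) / \<alpha>"
    using lpm_nonneg[of F "VaR \<alpha> F"] \<alpha> by simp
  then show "VaR_ES \<alpha> F \<in> U"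
    using VW(2) by (simp add: W_def U_def)
next
  fix x assume "x \<in> U"
  then obtain G1 G2 G3 where G: "G1 \<in> \<F>" "G2 \<in> \<F>" "G3 \<in> \<F>"
    and neg: "VW G1 G2 x < 0" "VW G2 G3 x < 0" "VW G3 G1 x < 0"
    using VW_triple by metis
  \<comment> \<open>The mixture with the barycentric coordinates of the origin annihilates
    \<open>V\<close> and \<open>W\<close> at \<open>x\<close>, hence has \<open>x\<close> as its
    value of \<open>VaR_ES\<close>.\<close>
  define c1 c2 c3 where c_def: "c1 = - VW G2 G3 x" "c2 = - VW G3 G1 x" "c3 = - VW G1 G2 x"
  have c: "0 < c1" "0 < c2" "0 < c3" using neg by (auto simp: c_def)
  have rel: "c1 * V G1 x + c2 * V G2 x + c3 * V G3 x = 0" "c1 * W G1 x + c2 * W G2 x + c3 * W G3 x = 0"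
    unfolding c_def VW_def by algebra+
  obtain H where H: "H \<in> \<F>" "\<And>\<Phi>. class_affine \<F> \<Phi> \<Longrightarrow>
      (c1 + c2 + c3) * \<Phi> H = c1 * \<Phi> G1 + c2 * \<Phi> G2 + c3 * \<Phi> G3"
    using convex_class_pos_combination3[OF convex G c] by blast
  have "V H x = 0" "W H x = 0"
    using H(2)[OF class_affine_V, of x] H(2)[OF class_affine_W, of x] rel c by auto
  then have "VaR_ES \<alpha> H = x" using VaR_ES_eq_iff_VW[OF H(1)] by simp
  then show "x \<in> VaR_ES \<alpha> ` \<F>" using H(1) by blast
qed

text \<open>Connects the \<open>deriv\<close> in \<open>partial1_V1\<close> with an actual
  derivative; \<open>V\<close> ignores the second coordinate, so \<open>v\<close> is free.\<close>

lemma partial1_V1_eq: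
  assumes F: "F \<in> \<F>"
  shows "((\<lambda>s. V F (s, v)) has_real_derivative partial1_V1 \<alpha> t F) (at (fst t))"
proof -
  interpret M: real_distribution "interval_measure F"
    by (rule real_distribution_distribution_function[OF in_class(1)[OF F]])
  have "fst (expected (ident_V \<alpha>) (s, snd t) F) = V F (s, v)" for s
  proof -
    have ind: "integrable (interval_measure F) (indicator {..s} :: real \<Rightarrow> real)"
      by (auto intro!: integrable_real_indicator simp: M.emeasure_finite less_top[symmetric])
    have i1: "integrable (interval_measure F) (\<lambda>y. indicator {..s} y - \<alpha>)"
      using ind by simp
    have "integrable (interval_measure F) (\<lambda>y. indicator {..s} y * y)"
      using integrable_mult_indicator[of "{..s}" "interval_measure F" "\<lambda>y. y"] in_class(2)[OF F]
      by (simp add: finite_first_moment_def)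
    then have i2: "integrable (interval_measure F) (\<lambda>y. snd t - 1 / \<alpha> * y * indicator {..s} y)"
      by (simp add: mult.commute)
    have "fst (expected (ident_V \<alpha>) (s, snd t) F) = (\<integral>y. indicator {..s} y - \<alpha> \<partial>interval_measure F)"
      using i1 i2 by (simp add: expected_def ident_V_def fst_integral_Pair)
    also have "\<dots> = F s - \<alpha>"
      using ind M.prob_space
      by (subst Bochner_Integration.integral_diff)
         (auto simp: measure_atMost_distribution_function[OF in_class(1)[OF F]])
    finally show ?thesis by (simp add: V_def)
  qed
  moreover obtain d where "((\<lambda>s. V F (s, v)) has_real_derivative d) (at (fst t))"
    using has_real_derivative_V[OF F, of "fst t"] by metis
  ultimately show ?thesis
    by (simp add: partial1_V1_def DERIV_imp_deriv)
qed

end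

section \<open>The gradient of the expected score\<close>

text \<open>Later \<open>r\<close> is a partial derivative of the expected score, and
  \<open>a\<close> and \<open>b\<close> form a row of the Osband matrix. The three distributions
  chosen at \<open>t\<close> still surround the origin at nearby points, so a single Cramer formula
  defines continuous coefficients on a neighbourhood.\<close>

lemma (in var_es_class) osband_local:
  fixes r :: "(real \<Rightarrow> real) \<Rightarrow> real \<times> real \<Rightarrow> real"
  assumes t: "t \<in> U"
    and cont: "\<And>F. F \<in> \<F> \<Longrightarrow> continuous_on U (r F)"
    and aff: "\<And>x. x \<in> U \<Longrightarrow> class_affine \<F> (\<lambda>F. r F x)"
    and zero: "\<And>F x. F \<in> \<F> \<Longrightarrow> x \<in> U \<Longrightarrow> V F x = 0 \<Longrightarrow> W F x = 0 \<Longrightarrow> r F x = 0"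
  obtains N a b where "open N" "t \<in> N" "N \<subseteq> U" "isCont a t" "isCont b t"
    "\<And>F x. F \<in> \<F> \<Longrightarrow> x \<in> N \<Longrightarrow> r F x = a x * V F x + b x * W F x"
proof -
  obtain G1 G2 G3 where G: "G1 \<in> \<F>" "G2 \<in> \<F>" "G3 \<in> \<F>"
    and neg: "VW G1 G2 t < 0" "VW G2 G3 t < 0" "VW G3 G1 t < 0"
    using VW_triple[OF t] by metis
  have contVW: "continuous_on X (VW F F')" if "F \<in> \<F>" "F' \<in> \<F>" for F F' X
    unfolding VW_def[abs_def] using that by (intro continuous_intros continuous_on_V continuous_on_W)
  have op: "open {x. VW F F' x < 0}" if "F \<in> \<F>" "F' \<in> \<F>" for F F'
    by (intro open_Collect_less contVW continuous_intros that)
  define N where "N = U \<inter> ({x. VW G1 G2 x < 0} \<inter> ({x. VW G2 G3 x < 0} \<inter> {x. VW G3 G1 x < 0}))"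
  have N: "open N" "t \<in> N" "N \<subseteq> U"
    using t neg by (auto simp: N_def intro!: open_Int op open_U G)
  define a where "a = (\<lambda>x. (W G2 x * r G1 x - W G1 x * r G2 x) / VW G1 G2 x)"
  define b where "b = (\<lambda>x. (V G1 x * r G2 x - V G2 x * r G1 x) / VW G1 G2 x)"
  have "continuous_on N a" "continuous_on N b"
    unfolding a_def b_def
    by (intro continuous_intros continuous_on_V continuous_on_W contVW G
        continuous_on_subset[OF cont N(3)]; force simp: N_def)+
  then have "isCont a t" "isCont b t"
    using N by (auto simp: continuous_on_eq_continuous_at)
  moreover have "r F x = a x * V F x + b x * W F x" if F: "F \<in> \<F>" and x: "x \<in> N" for F x
  proof -
    have nz: "VW G1 G2 x \<noteq> 0" using x by (auto simp: N_def)
    have "VW G1 G2 x * r F x = VW F G2 x * r G1 x + VW G1 F x * r G2 x"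
      unfolding VW_def
      by (rule osband_class_affine[OF convex class_affine_V class_affine_W aff _ G _ _ _ F])
         (use x zero in \<open>auto simp: N_def VW_def\<close>)
    also have "\<dots> = VW G1 G2 x * (a x * V F x + b x * W F x)"
      using nz by (simp add: a_def b_def distrib_left) (simp add: VW_def algebra_simps)
    finally show ?thesis using nz by simp
  qed
  ultimately show ?thesis using N that by blast
qed

locale var_es_scores = var_es_class +
  fixes S :: "real \<times> real \<Rightarrow> real \<Rightarrow> real"
  assumes scoring: "scoring_function \<F> U S"
    and consistent: "consistent \<F> U (VaR_ES \<alpha>) S"
    and loc_bounded: "\<forall>x\<in>U. locally_bounded (S x)"
    and smooth: "\<forall>F\<in>\<F>. score_smooth U (VaR_ES \<alpha> F) (\<lambda>x. expected S x F)"
    and separating: "\<forall>t\<in>U. \<exists>F1\<in>\<F>. \<exists>F2\<in>\<F>.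
      VaR_ES \<alpha> F1 = t \<and> VaR_ES \<alpha> F2 = t \<and> partial1_V1 \<alpha> t F1 \<noteq> partial1_V1 \<alpha> t F2"
begin

text \<open>\<open>score_smooth\<close> yields a gradient for each \<open>F\<close> separately;
  \<open>deriv\<close> fixes one function of \<open>F\<close> and \<open>x\<close>, whose affinity
  in \<open>F\<close> can then be stated.\<close>

definition p :: "(real \<Rightarrow> real) \<Rightarrow> real \<times> real \<Rightarrow> real" where
  "p F x = deriv (\<lambda>s. expected S (s, snd x) F) (fst x)"

definition q :: "(real \<Rightarrow> real) \<Rightarrow> real \<times> real \<Rightarrow> real" where
  "q F x = deriv (\<lambda>s. expected S (fst x, s) F) (snd x)"

lemma
  assumes F: "F \<in> \<F>"
  shows has_real_derivative_p:
      "x \<in> U \<Longrightarrow> ((\<lambda>s. expected S (s, snd x) F) has_real_derivative p F x) (at (fst x))"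
    and has_real_derivative_q:
      "x \<in> U \<Longrightarrow> ((\<lambda>s. expected S (fst x, s) F) has_real_derivative q F x) (at (snd x))"
    and continuous_on_p: "continuous_on U (p F)"
    and continuous_on_q: "continuous_on U (q F)"
    and symmetric_pq: "VaR_ES \<alpha> F \<in> U \<Longrightarrow> \<exists>p' q'. (p F has_derivative p') (at (VaR_ES \<alpha> F)) \<and>
       (q F has_derivative q') (at (VaR_ES \<alpha> F)) \<and> p' (0, 1) = q' (1, 0)"
proof -
  obtain p0 q0 where c: "continuous_on U p0" "continuous_on U q0"
    and p0: "\<And>x. x \<in> U \<Longrightarrow> ((\<lambda>s. expected S (s, snd x) F) has_real_derivative p0 x) (at (fst x))"
    and q0: "\<And>x. x \<in> U \<Longrightarrow> ((\<lambda>s. expected S (fst x, s) F) has_real_derivative q0 x) (at (snd x))"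
    and sym: "VaR_ES \<alpha> F \<in> U \<Longrightarrow> \<exists>p' q'. (p0 has_derivative p') (at (VaR_ES \<alpha> F)) \<and>
       (q0 has_derivative q') (at (VaR_ES \<alpha> F)) \<and> p' (0, 1) = q' (1, 0)"
    by (rule score_smooth_partials[OF smooth[rule_format, OF F] open_U]) (rule that, assumption+)
  have eq: "p F x = p0 x" "q F x = q0 x" if "x \<in> U" for x
    using DERIV_imp_deriv[OF p0[OF that]] DERIV_imp_deriv[OF q0[OF that]] by (simp_all add: p_def q_def)
  show "((\<lambda>s. expected S (s, snd x) F) has_real_derivative p F x) (at (fst x))" if "x \<in> U"
    using p0[OF that] eq(1)[OF that] by simp
  show "((\<lambda>s. expected S (fst x, s) F) has_real_derivative q F x) (at (snd x))" if "x \<in> U"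
    using q0[OF that] eq(2)[OF that] by simp
  show "continuous_on U (p F)"
    using c(1) by (rule continuous_on_eq) (simp add: eq)
  show "continuous_on U (q F)"
    using c(2) by (rule continuous_on_eq) (simp add: eq)
  assume t: "VaR_ES \<alpha> F \<in> U"
  obtain p' q' where p': "(p0 has_derivative p') (at (VaR_ES \<alpha> F))"
    and q': "(q0 has_derivative q') (at (VaR_ES \<alpha> F))" and sym': "p' (0, 1) = q' (1, 0)"
    using sym[OF t] by blast
  have "(p F has_derivative p') (at (VaR_ES \<alpha> F))" "(q F has_derivative q') (at (VaR_ES \<alpha> F))"
    by (rule has_derivative_transform_within_open[OF p' open_U t] has_derivative_transform_within_open[OF q' open_U t],
        simp add: eq)+
  with sym' show "\<exists>p' q'. (p F has_derivative p') (at (VaR_ES \<alpha> F)) \<and>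
       (q F has_derivative q') (at (VaR_ES \<alpha> F)) \<and> p' (0, 1) = q' (1, 0)"
    by blast
qed

lemma U_eventually:
  assumes "x \<in> U"
  shows "eventually (\<lambda>s. (s, snd x) \<in> U) (nhds (fst x))" "eventually (\<lambda>s. (fst x, s) \<in> U) (nhds (snd x))"
  using assms eventually_nhds_in_open[of "{snd x<..}" "fst x"] eventually_nhds_in_open[of "{..<fst x}" "snd x"]
  by (simp_all add: U_def)

lemma class_affine_expected: "x \<in> U \<Longrightarrow> class_affine \<F> (\<lambda>F. expected S x F)"
  unfolding expected_def
  using scoring by (intro class_affine_integral) (auto simp: scoring_function_def)

lemma class_affine_p:
  assumes x: "x \<in> U"
  shows "class_affine \<F> (\<lambda>F. p F x)"
  unfolding class_affine_def
proof (intro ballI)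
  fix F G l assume FG: "F \<in> \<F>" "G \<in> \<F>" and l: "l \<in> {0..1::real}"
  define H where "H = (\<lambda>y. (1 - l) * F y + l * G y)"
  have ev: "eventually (\<lambda>s. expected S (s, snd x) H =
      (1 - l) * expected S (s, snd x) F + l * expected S (s, snd x) G) (nhds (fst x))"
    using U_eventually(1)[OF x]
    by eventually_elim (use class_affine_expected FG l in \<open>auto simp: class_affine_def H_def\<close>)
  have "((\<lambda>s. (1 - l) * expected S (s, snd x) F + l * expected S (s, snd x) G)
      has_real_derivative (1 - l) * p F x + l * p G x) (at (fst x))"
    by (intro DERIV_add DERIV_cmult has_real_derivative_p FG x)
  then have "((\<lambda>s. expected S (s, snd x) H) has_real_derivative (1 - l) * p F x + l * p G x) (at (fst x))"
    by (subst DERIV_cong_ev[OF refl ev refl])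
  then show "p (\<lambda>y. (1 - l) * F y + l * G y) x = (1 - l) * p F x + l * p G x"
    unfolding H_def[symmetric] by (simp add: p_def[of H] DERIV_imp_deriv)
qed

lemma class_affine_q:
  assumes x: "x \<in> U"
  shows "class_affine \<F> (\<lambda>F. q F x)"
  unfolding class_affine_def
proof (intro ballI)
  fix F G l assume FG: "F \<in> \<F>" "G \<in> \<F>" and l: "l \<in> {0..1::real}"
  define H where "H = (\<lambda>y. (1 - l) * F y + l * G y)"
  have ev: "eventually (\<lambda>s. expected S (fst x, s) H =
      (1 - l) * expected S (fst x, s) F + l * expected S (fst x, s) G) (nhds (snd x))"
    using U_eventually(2)[OF x]
    by eventually_elim (use class_affine_expected FG l in \<open>auto simp: class_affine_def H_def\<close>)
  have "((\<lambda>s. (1 - l) * expected S (fst x, s) F + l * expected S (fst x, s) G)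
      has_real_derivative (1 - l) * q F x + l * q G x) (at (snd x))"
    by (intro DERIV_add DERIV_cmult has_real_derivative_q FG x)
  then have "((\<lambda>s. expected S (fst x, s) H) has_real_derivative (1 - l) * q F x + l * q G x) (at (snd x))"
    by (subst DERIV_cong_ev[OF refl ev refl])
  then show "q (\<lambda>y. (1 - l) * F y + l * G y) x = (1 - l) * q F x + l * q G x"
    unfolding H_def[symmetric] by (simp add: q_def[of H] DERIV_imp_deriv)
qed

text \<open>First-order condition: \<open>x\<close> is the value of \<open>VaR_ES\<close> at
  \<open>F\<close>, hence minimises the expected score, and it is an interior point of
  \<open>U\<close>.\<close>

lemma pq_zero:
  assumes F: "F \<in> \<F>" and x: "x \<in> U" and VW0: "V F x = 0" "W F x = 0"
  shows "p F x = 0" "q F x = 0"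
proof -
  have T: "VaR_ES \<alpha> F = x" using VaR_ES_eq_iff_VW[OF F] VW0 by simp
  have min: "expected S x F \<le> expected S z F" if "z \<in> U" for z
    using consistent F that T by (auto simp: consistent_def)
  obtain d where d: "0 < d" "\<And>s. \<bar>fst x - s\<bar> < d \<Longrightarrow> (s, snd x) \<in> U"
    using U_eventually(1)[OF x] by (auto simp: eventually_nhds_metric dist_real_def abs_minus_commute)
  show "p F x = 0"
    by (rule DERIV_local_min[OF has_real_derivative_p[OF F x] d(1)]) (use min d(2) in auto)
  obtain e where e: "0 < e" "\<And>s. \<bar>snd x - s\<bar> < e \<Longrightarrow> (fst x, s) \<in> U"
    using U_eventually(2)[OF x] by (auto simp: eventually_nhds_metric dist_real_def abs_minus_commute)
  show "q F x = 0"
    by (rule DERIV_local_min[OF has_real_derivative_q[OF F x] e(1)]) (use min e(2) in auto)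
qed

text \<open>Near \<open>t\<close> the partial derivatives are \<open>a V + b W\<close> and
  \<open>c V + d W\<close>. For \<open>F\<close> with value \<open>t\<close>, symmetry of the
  Hessian reads \<open>b t = c t * partial1_V1 \<alpha> t F\<close>. Two distributions with
  different \<open>partial1_V1\<close> force \<open>c t = 0\<close> and then
  \<open>b t = 0\<close>.\<close>

lemma pq_diagonal:
  assumes t: "t \<in> U"
  shows "\<exists>\<phi> \<psi>. \<forall>F\<in>\<F>. p F t = \<phi> * V F t \<and> q F t = \<psi> * W F t"
proof -
  obtain N a b where N: "open N" "t \<in> N" "N \<subseteq> U" and ab: "isCont a t" "isCont b t"
    and p: "\<And>F x. F \<in> \<F> \<Longrightarrow> x \<in> N \<Longrightarrow> p F x = a x * V F x + b x * W F x"
    by (rule osband_local[OF t, of p], erule continuous_on_p, erule class_affine_p,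
        rule pq_zero(1), assumption+, rule that, assumption+)
  obtain M c d where M: "open M" "t \<in> M" "M \<subseteq> U" and cd: "isCont c t" "isCont d t"
    and q: "\<And>F x. F \<in> \<F> \<Longrightarrow> x \<in> M \<Longrightarrow> q F x = c x * V F x + d x * W F x"
    by (rule osband_local[OF t, of q], erule continuous_on_q, erule class_affine_q,
        rule pq_zero(2), assumption+, rule that, assumption+)
  have key: "b t = c t * partial1_V1 \<alpha> t F" if F: "F \<in> \<F>" and T: "VaR_ES \<alpha> F = t" for F
  proof -
    have VW0: "V F t = 0" "W F t = 0" using VaR_ES_eq_iff_VW[OF F, of t] T by auto
    obtain p' q' where p': "(p F has_derivative p') (at t)" and q': "(q F has_derivative q') (at t)"
      and eq: "p' (0, 1) = q' (1, 0)"
      using symmetric_pq[OF F] T t by auto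
    have *: "((\<lambda>s. p F (fst t, s)) has_derivative (\<lambda>h. p' (0, h))) (at (snd t))"
      by (rule has_derivative_compose[of "\<lambda>s. (fst t, s)" _ _ _ "p F"])
         (use p' in \<open>auto intro!: derivative_eq_intros\<close>)
    have 1: "((\<lambda>s. p F (fst t, s)) has_real_derivative p' (0, 1)) (at (snd t))"
    proof -
      have "p' (0, h) = p' (0, 1) * h" for h
        using linear_scale[OF has_derivative_linear[OF p'], of h "(0, 1)"] by (simp add: mult.commute)
      then have "(\<lambda>h. p' (0, h)) = (*) (p' (0, 1))" by (intro ext)
      with * show ?thesis by (simp only: has_field_derivative_def)
    qed
    have *: "((\<lambda>s. q F (s, snd t)) has_derivative (\<lambda>h. q' (h, 0))) (at (fst t))"
      by (rule has_derivative_compose[of "\<lambda>s. (s, snd t)" _ _ _ "q F"])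
         (use q' in \<open>auto intro!: derivative_eq_intros\<close>)
    have 2: "((\<lambda>s. q F (s, snd t)) has_real_derivative q' (1, 0)) (at (fst t))"
    proof -
      have "q' (h, 0) = q' (1, 0) * h" for h
        using linear_scale[OF has_derivative_linear[OF q'], of h "(1, 0)"] by (simp add: mult.commute)
      then have "(\<lambda>h. q' (h, 0)) = (*) (q' (1, 0))" by (intro ext)
      with * show ?thesis by (simp only: has_field_derivative_def)
    qed
    have cont: "isCont (\<lambda>s. h (fst t, s)) (snd t)" "isCont (\<lambda>s. h (s, snd t)) (fst t)"
      if "isCont h t" for h :: "real \<times> real \<Rightarrow> real"
    proof -
      have "isCont (\<lambda>s. (fst t, s)) (snd t)" "isCont (\<lambda>s. (s, snd t)) (fst t)"
        by (intro continuous_Pair continuous_const continuous_ident)+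
      from this[THEN isCont_o2, of h] that
      show "isCont (\<lambda>s. h (fst t, s)) (snd t)" "isCont (\<lambda>s. h (s, snd t)) (fst t)"
        by simp_all
    qed
    have evN: "eventually (\<lambda>s. (fst t, s) \<in> N) (nhds (snd t))"
      using N(2) eventually_nhds_in_open[of "Pair (fst t) -` N" "snd t"]
      by (simp add: open_vimage[OF N(1)] continuous_on_Pair)
    have evM: "eventually (\<lambda>s. (s, snd t) \<in> M) (nhds (fst t))"
      using M(2) eventually_nhds_in_open[of "(\<lambda>s. (s, snd t)) -` M" "fst t"]
      by (simp add: open_vimage[OF M(1)] continuous_on_Pair)
    \<comment> \<open>\<open>V\<close> is constant along vertical lines, so the term with
      \<open>a\<close> disappears and only \<open>b\<close> times the unit derivative of
      \<open>W\<close> contributes.\<close>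
    have V0: "V F (fst t, s) = 0" for s using VW0(1) by (simp add: V_def)
    have "((\<lambda>s. b (fst t, s) * W F (fst t, s)) has_real_derivative b (fst t, snd t) * 1) (at (snd t))"
      using VW0 by (intro has_real_derivative_mult_zero cont ab has_real_derivative_W_snd) auto
    moreover have "eventually (\<lambda>s. p F (fst t, s) = b (fst t, s) * W F (fst t, s)) (nhds (snd t))"
      using evN by eventually_elim (simp add: p[OF F] V0)
    ultimately have "((\<lambda>s. p F (fst t, s)) has_real_derivative b t) (at (snd t))"
      by (subst DERIV_cong_ev[OF refl _ refl]) auto
    with 1 have pb: "p' (0, 1) = b t" by (rule DERIV_unique)
    \<comment> \<open>The coefficients are only continuous at \<open>t\<close>, but \<open>V\<close>
      and \<open>W\<close> vanish there. The term with \<open>d\<close> carries the derivative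
      \<open>V / \<alpha>\<close> of \<open>W\<close>, which is zero at \<open>t\<close>.\<close>
    have "((\<lambda>s. c (s, snd t) * V F (s, snd t) + d (s, snd t) * W F (s, snd t)) has_real_derivative
        c (fst t, snd t) * partial1_V1 \<alpha> t F + d (fst t, snd t) * (V F (fst t, snd t) / \<alpha>)) (at (fst t))"
      using VW0 by (intro DERIV_add has_real_derivative_mult_zero cont cd partial1_V1_eq F
          has_real_derivative_W_fst) auto
    moreover have "eventually (\<lambda>s. q F (s, snd t) =
        c (s, snd t) * V F (s, snd t) + d (s, snd t) * W F (s, snd t)) (nhds (fst t))"
      using evM by eventually_elim (simp add: q[OF F])
    ultimately have "((\<lambda>s. q F (s, snd t)) has_real_derivative c t * partial1_V1 \<alpha> t F) (at (fst t))"
      using VW0 by (subst DERIV_cong_ev[OF refl _ refl]) auto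
    with 2 have "q' (1, 0) = c t * partial1_V1 \<alpha> t F" by (rule DERIV_unique)
    with eq pb show ?thesis by simp
  qed
  obtain F1 F2 where F12: "F1 \<in> \<F>" "F2 \<in> \<F>" "VaR_ES \<alpha> F1 = t" "VaR_ES \<alpha> F2 = t"
    "partial1_V1 \<alpha> t F1 \<noteq> partial1_V1 \<alpha> t F2"
    using separating t by blast
  have "c t = 0" using key[OF F12(1,3)] key[OF F12(2,4)] F12(5) by simp
  moreover from this have "b t = 0" using key[OF F12(1,3)] by simp
  ultimately show ?thesis
    using p[OF _ N(2)] q[OF _ M(2)] by (intro exI[of _ "a t"] exI[of _ "d t"]) auto
qed

text \<open>The pointwise factors are collected into functions. Their continuity follows by dividing
  a continuous partial derivative by \<open>V\<close> or \<open>W\<close> of a distribution for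
  which the divisor is nonzero near the point.\<close>

lemma pq_factors:
  obtains \<phi> \<psi> where "continuous_on U \<phi>" "continuous_on U \<psi>"
    "\<And>F x. F \<in> \<F> \<Longrightarrow> x \<in> U \<Longrightarrow> p F x = \<phi> x * V F x"
    "\<And>F x. F \<in> \<F> \<Longrightarrow> x \<in> U \<Longrightarrow> q F x = \<psi> x * W F x"
proof -
  obtain \<phi> \<psi> where pq: "\<And>F x. F \<in> \<F> \<Longrightarrow> x \<in> U \<Longrightarrow> p F x = \<phi> x * V F x"
    "\<And>F x. F \<in> \<F> \<Longrightarrow> x \<in> U \<Longrightarrow> q F x = \<psi> x * W F x"
    using pq_diagonal by metis
  have quot: "isCont h x" if x: "x \<in> U" and nz: "w x \<noteq> 0" and w: "continuous_on U w"
    and r: "continuous_on U r" and eq: "\<And>z. z \<in> U \<Longrightarrow> r z = h z * w z"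
    for h w r :: "real \<times> real \<Rightarrow> real" and x
  proof -
    have "isCont (\<lambda>z. r z / w z) x"
      using x nz w r open_U by (intro continuous_intros) (auto simp: continuous_on_eq_continuous_at)
    moreover have "eventually (\<lambda>z. w z \<noteq> 0) (nhds x)"
    proof -
      have "isCont w x" using w x open_U by (auto simp: continuous_on_eq_continuous_at)
      then have "(w \<longlongrightarrow> w x) (nhds x)" by (simp add: isCont_def tendsto_at_iff_tendsto_nhds)
      then show ?thesis using nz tendsto_imp_eventually_ne by blast
    qed
    then have "eventually (\<lambda>z. r z / w z = h z) (nhds x)"
      using eventually_nhds_in_open[OF open_U x] by eventually_elim (simp add: eq)
    ultimately show ?thesis using isCont_cong[of "\<lambda>z. r z / w z" h x] by blast
  qed
  have "isCont \<phi> x \<and> isCont \<psi> x" if x: "x \<in> U" for x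
  proof -
    obtain G1 G2 G3 where G: "G1 \<in> \<F>" "G2 \<in> \<F>" "VW G1 G2 x < 0" using VW_triple[OF x] by metis
    \<comment> \<open>A nonzero determinant excludes that \<open>V\<close> vanishes for both
      distributions, and likewise \<open>W\<close>.\<close>
    then obtain G G' where GG: "G \<in> \<F>" "V G x \<noteq> 0" "G' \<in> \<F>" "W G' x \<noteq> 0"
      unfolding VW_def by (metis less_irrefl mult_zero_left mult_zero_right diff_0_right diff_self)
    show ?thesis
      using quot[OF x GG(2) continuous_on_V[OF GG(1)] continuous_on_p[OF GG(1)] pq(1)[OF GG(1)]]
        quot[OF x GG(4) continuous_on_W[OF GG(3)] continuous_on_q[OF GG(3)] pq(2)[OF GG(3)]]
      by blast
  qed
  then show ?thesis
    by (intro that[OF _ _ pq] continuous_at_imp_continuous_on) auto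
qed

end

section \<open>Integration around rectangles\<close>

text \<open>Differentiating within the closed interval includes its end points; the left end point
  is where the result is applied.\<close>

lemma continuous_eq_zero_if_integrals_zero:
  fixes h :: "real \<Rightarrow> real"
  assumes "continuous_on {c..e} h" "c < e" "\<And>x. x \<in> {c..e} \<Longrightarrow> integral {c..x} h = 0" "x \<in> {c..e}"
  shows "h x = 0"
proof -
  have "((\<lambda>u. integral {c..u} h) has_real_derivative h x) (at x within {c..e})"
    by (rule integral_has_real_derivative) (use assms in auto)
  moreover have "((\<lambda>u. integral {c..u} h) has_real_derivative 0) (at x within {c..e})"
    by (rule has_field_derivative_transform_within[of "\<lambda>_. 0" 0 x "{c..e}" 1])
       (use assms in auto)
  moreover have "at x within {c..e} \<noteq> bot"
    using assms by (simp add: trivial_limit_within islimpt_Icc)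
  ultimately show ?thesis
    unfolding has_field_derivative_iff by (rule tendsto_unique[rotated])
qed

lemma ex_antiderivative:
  fixes g :: "real \<Rightarrow> real"
  assumes "continuous_on UNIV g"
  obtains G where "\<And>x. (G has_real_derivative g x) (at x)"
proof -
  have "\<exists>F. \<forall>x. - \<infinity> < ereal x \<longrightarrow> ereal x < \<infinity> \<longrightarrow> (F has_vector_derivative g x) (at x)"
    using assms by (intro einterval_antiderivative) (auto simp: continuous_on_eq_continuous_at)
  then show ?thesis
    using that by (auto simp: has_real_derivative_iff_has_vector_derivative)
qed

text \<open>Monotone functions whose values at both end points tend to the same \<open>k\<close>
  converge to \<open>k\<close> uniformly in between.\<close>

lemma integral_mult_mono_tendsto:
  fixes g :: "real \<Rightarrow> real" and Fn :: "nat \<Rightarrow> real \<Rightarrow> real"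
  assumes ab: "a \<le> b" and g: "continuous_on {a..b} g"
    and mono: "\<And>n. mono (Fn n)" and cont: "\<And>n. continuous_on {a..b} (Fn n)"
    and lim: "(\<lambda>n. Fn n a) \<longlonglongrightarrow> k" "(\<lambda>n. Fn n b) \<longlonglongrightarrow> k"
  shows "(\<lambda>n. integral {a..b} (\<lambda>s. g s * Fn n s)) \<longlonglongrightarrow> integral {a..b} (\<lambda>s. g s * k)"
proof -
  obtain B where B: "\<And>s. s \<in> {a..b} \<Longrightarrow> norm (g s) \<le> B"
    using compact_imp_bounded[OF compact_continuous_image[OF g compact_Icc]]
    unfolding bounded_iff by blast
  have "0 \<le> B" using B[of a] ab by force
  define e where "e = (\<lambda>n. \<bar>Fn n a - k\<bar> + \<bar>Fn n b - k\<bar>)"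
  have e: "(\<lambda>n. B * e n * (b - a)) \<longlonglongrightarrow> 0"
    unfolding e_def by (rule tendsto_eq_intros lim refl)+ simp
  have "norm (integral {a..b} (\<lambda>s. g s * Fn n s) - integral {a..b} (\<lambda>s. g s * k)) \<le> B * e n * (b - a)" for n
  proof -
    have "integral {a..b} (\<lambda>s. g s * Fn n s) - integral {a..b} (\<lambda>s. g s * k) =
        integral {a..b} (\<lambda>s. g s * (Fn n s - k))"
      unfolding right_diff_distrib
      by (intro integral_diff[symmetric] integrable_continuous_interval continuous_intros g cont)
    also have "norm \<dots> \<le> B * e n * (b - a)"
    proof (rule integral_bound[OF ab])
      show "continuous_on {a..b} (\<lambda>s. g s * (Fn n s - k))" by (intro continuous_intros g cont)
      fix s assume s: "s \<in> {a..b}"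
      have "\<bar>Fn n s - k\<bar> \<le> e n"
        using monoD[OF mono, of a s n] monoD[OF mono, of s b n] s by (auto simp: e_def)
      then show "norm (g s * (Fn n s - k)) \<le> B * e n"
        using B[OF s] \<open>0 \<le> B\<close> by (auto simp: abs_mult intro!: mult_mono)
    qed
    finally show ?thesis .
  qed
  then have "(\<lambda>n. integral {a..b} (\<lambda>s. g s * Fn n s) - integral {a..b} (\<lambda>s. g s * k)) \<longlonglongrightarrow> 0"
    by (intro Lim_null_comparison[OF _ e]) auto
  then show ?thesis by (simp add: LIM_zero_iff)
qed

context var_es_scores
begin

context
  fixes \<phi> \<psi> :: "real \<times> real \<Rightarrow> real"
  assumes cont_\<phi>: "continuous_on U \<phi>" and cont_\<psi>: "continuous_on U \<psi>"
    and p_eq: "\<And>F x. F \<in> \<F> \<Longrightarrow> x \<in> U \<Longrightarrow> p F x = \<phi> x * V F x"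
    and q_eq: "\<And>F x. F \<in> \<F> \<Longrightarrow> x \<in> U \<Longrightarrow> q F x = \<psi> x * W F x"
begin

lemma continuous_on_\<phi>_fst: "d < a \<Longrightarrow> continuous_on {a..b} (\<lambda>s. \<phi> (s, d))"
  by (rule continuous_on_compose2[OF cont_\<phi>]) (auto intro!: continuous_intros simp: U_def)

lemma continuous_on_\<psi>_snd: "d < a \<Longrightarrow> continuous_on {c..d} (\<lambda>t. \<psi> (a, t))"
  by (rule continuous_on_compose2[OF cont_\<psi>]) (auto intro!: continuous_intros simp: U_def)

text \<open>The gradient integrates to zero around the rectangle with sides \<open>{a..b}\<close>
  and \<open>{c..d}\<close>: horizontal edges on the left, vertical edges on the right. The
  condition \<open>d < a\<close> keeps the rectangle inside \<open>U\<close>.\<close>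

lemma loop_integral:
  assumes F: "F \<in> \<F>" and ord: "c \<le> d" "d < a" "a \<le> b"
  shows "integral {a..b} (\<lambda>s. (\<phi> (s, d) - \<phi> (s, c)) * (F s - \<alpha>)) =
    integral {c..d} (\<lambda>t. \<psi> (b, t) * W F (b, t)) - integral {c..d} (\<lambda>t. \<psi> (a, t) * W F (a, t))"
proof -
  have 1: "((\<lambda>s. \<phi> (s, v) * (F s - \<alpha>)) has_integral expected S (b, v) F - expected S (a, v) F) {a..b}"
    if "v \<le> d" for v
  proof (rule fundamental_theorem_of_calculus[OF ord(3)])
    fix s assume "s \<in> {a..b}"
    then have s: "(s, v) \<in> U" using that ord by (auto simp: U_def)
    show "((\<lambda>s. expected S (s, v) F) has_vector_derivative \<phi> (s, v) * (F s - \<alpha>)) (at s within {a..b})"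
      using has_real_derivative_p[OF F s] p_eq[OF F s]
      by (simp add: V_def has_real_derivative_iff_has_vector_derivative has_vector_derivative_at_within)
  qed
  have 2: "((\<lambda>t. \<psi> (u, t) * W F (u, t)) has_integral expected S (u, d) F - expected S (u, c) F) {c..d}"
    if "a \<le> u" for u
  proof (rule fundamental_theorem_of_calculus[OF ord(1)])
    fix t assume "t \<in> {c..d}"
    then have t: "(u, t) \<in> U" using that ord by (auto simp: U_def)
    show "((\<lambda>t. expected S (u, t) F) has_vector_derivative \<psi> (u, t) * W F (u, t)) (at t within {c..d})"
      using has_real_derivative_q[OF F t] q_eq[OF F t]
      by (simp add: has_real_derivative_iff_has_vector_derivative has_vector_derivative_at_within)
  qed
  have "((\<lambda>s. (\<phi> (s, d) - \<phi> (s, c)) * (F s - \<alpha>)) has_integral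
      (expected S (b, d) F - expected S (a, d) F) - (expected S (b, c) F - expected S (a, c) F)) {a..b}"
    using has_integral_diff[OF 1[of d] 1[of c]] ord by (simp add: left_diff_distrib)
  from integral_unique[OF this] integral_unique[OF 2[of a]] integral_unique[OF 2[of b]] ord
  show ?thesis by simp
qed

lemma loop_integral_dirac:
  assumes ord: "c \<le> d" "d < a" "a \<le> b" and y: "y \<notin> {a..b}"
  defines "k \<equiv> if y < a then 1 else 0"
  defines "\<Psi> \<equiv> \<lambda>u. integral {c..d} (\<lambda>t. \<psi> (u, t))"
  defines "J \<equiv> \<lambda>u. integral {c..d} (\<lambda>t. \<psi> (u, t) * (t - u))"
  shows "(k - \<alpha>) * integral {a..b} (\<lambda>s. \<phi> (s, d) - \<phi> (s, c)) =
    (J b + max 0 (b - y) / \<alpha> * \<Psi> b) - (J a + max 0 (a - y) / \<alpha> * \<Psi> a)"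
proof -
  obtain Fn where dirac: "approaches_dirac Fn y" using ex_approaches_dirac by blast
  note Fn = approaches_dirac_in_class[OF dirac]
    and lim = approaches_dirac_cdf[OF dirac] approaches_dirac_lpm[OF dirac]
  have cont: "continuous_on {a..b} (\<lambda>s. \<phi> (s, d) - \<phi> (s, c))"
    using ord by (intro continuous_intros continuous_on_\<phi>_fst) auto
  have monoF: "mono (Fn n)" and contF: "continuous_on X (Fn n)" for n X
    using distribution_functionD(1) isCont_distribution_function in_class[OF Fn]
    by (auto intro!: continuous_at_imp_continuous_on)
  \<comment> \<open>With \<open>y\<close> outside the interval, the distribution functions tend to 1
    on it if \<open>y\<close> lies to the left and to 0 if \<open>y\<close> lies to the
    right.\<close>
  have "(\<lambda>n. integral {a..b} (\<lambda>s. (\<phi> (s, d) - \<phi> (s, c)) * (Fn n s - \<alpha>))) \<longlonglongrightarrow>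
      integral {a..b} (\<lambda>s. (\<phi> (s, d) - \<phi> (s, c)) * (k - \<alpha>))"
  proof (rule integral_mult_mono_tendsto[OF ord(3) cont])
    have "(\<lambda>n. Fn n a) \<longlonglongrightarrow> k" "(\<lambda>n. Fn n b) \<longlonglongrightarrow> k"
      using lim(1)[of a] lim(1)[of b] y ord by (auto simp: k_def indicator_def split: if_splits)
    then show "(\<lambda>n. Fn n a - \<alpha>) \<longlonglongrightarrow> k - \<alpha>" "(\<lambda>n. Fn n b - \<alpha>) \<longlonglongrightarrow> k - \<alpha>"
      by (auto intro: tendsto_diff)
  qed (use monoF in \<open>auto simp: mono_def intro!: continuous_intros contF\<close>)
  moreover have "integral {a..b} (\<lambda>s. (\<phi> (s, d) - \<phi> (s, c)) * (k - \<alpha>)) =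
      (k - \<alpha>) * integral {a..b} (\<lambda>s. \<phi> (s, d) - \<phi> (s, c))"
    by (simp add: mult.commute)
  ultimately have L: "(\<lambda>n. integral {a..b} (\<lambda>s. (\<phi> (s, d) - \<phi> (s, c)) * (Fn n s - \<alpha>))) \<longlonglongrightarrow>
      (k - \<alpha>) * integral {a..b} (\<lambda>s. \<phi> (s, d) - \<phi> (s, c))"
    by (simp add: mult.commute)
  \<comment> \<open>Only the \<open>lpm\<close> part of \<open>W\<close> depends on the
    distribution, and it is constant along a vertical edge.\<close>
  have W: "integral {c..d} (\<lambda>t. \<psi> (u, t) * W F (u, t)) = J u + lpm F u / \<alpha> * \<Psi> u" if "a \<le> u" for u F
  proof -
    have "continuous_on {c..d} (\<lambda>t. \<psi> (u, t))"
      using that ord by (intro continuous_on_\<psi>_snd) auto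
    then have "integral {c..d} (\<lambda>t. \<psi> (u, t) * (t - u) + lpm F u / \<alpha> * \<psi> (u, t)) = J u + lpm F u / \<alpha> * \<Psi> u"
      unfolding J_def \<Psi>_def
      using \<alpha> by (subst integral_add) (auto intro!: integrable_continuous_interval continuous_intros)
    then show ?thesis by (simp add: W_def algebra_simps)
  qed
  have R: "(\<lambda>n. (J b + lpm (Fn n) b / \<alpha> * \<Psi> b) - (J a + lpm (Fn n) a / \<alpha> * \<Psi> a)) \<longlonglongrightarrow>
      (J b + max 0 (b - y) / \<alpha> * \<Psi> b) - (J a + max 0 (a - y) / \<alpha> * \<Psi> a)"
    using \<alpha> by (intro tendsto_intros lim) auto
  have "(\<lambda>n. integral {a..b} (\<lambda>s. (\<phi> (s, d) - \<phi> (s, c)) * (Fn n s - \<alpha>))) =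
      (\<lambda>n. (J b + lpm (Fn n) b / \<alpha> * \<Psi> b) - (J a + lpm (Fn n) a / \<alpha> * \<Psi> a))"
    using loop_integral[OF Fn ord] W ord by auto
  from L[unfolded this] R show ?thesis by (rule LIMSEQ_unique)
qed

lemma loop_consequences:
  assumes ord: "c \<le> d" "d < a" "a \<le> b"
  shows "integral {c..d} (\<lambda>t. \<psi> (b, t)) = integral {c..d} (\<lambda>t. \<psi> (a, t))"
    and "integral {a..b} (\<lambda>s. \<phi> (s, d) - \<phi> (s, c)) = (b - a) / \<alpha> * integral {c..d} (\<lambda>t. \<psi> (a, t))"
proof -
  define D where "D = integral {a..b} (\<lambda>s. \<phi> (s, d) - \<phi> (s, c))"
  define \<Psi> where "\<Psi> = (\<lambda>u. integral {c..d} (\<lambda>t. \<psi> (u, t)))"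
  define J where "J = (\<lambda>u. integral {c..d} (\<lambda>t. \<psi> (u, t) * (t - u)))"
  note L = loop_integral_dirac[OF ord]
  \<comment> \<open>A Dirac point to the right gives \<open>k = 0\<close> and no positive parts. Two
    points at distance one to the left give \<open>k = 1\<close> and positive parts that differ by
    one, which isolates \<open>\<Psi> b - \<Psi> a\<close>.\<close>
  have 0: "- \<alpha> * D = J b - J a" using L[of "b + 1"] ord by (simp add: D_def J_def \<Psi>_def)
  have 1: "(1 - \<alpha>) * D = (J b + (b - a + 1) / \<alpha> * \<Psi> b) - (J a + 1 / \<alpha> * \<Psi> a)"
    using L[of "a - 1"] ord by (simp add: D_def J_def \<Psi>_def)
  have 2: "(1 - \<alpha>) * D = (J b + (b - a + 2) / \<alpha> * \<Psi> b) - (J a + 2 / \<alpha> * \<Psi> a)"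
    using L[of "a - 2"] ord by (simp add: D_def J_def \<Psi>_def)
  have "(1 / \<alpha>) * (\<Psi> b - \<Psi> a) = ((J b + (b - a + 2) / \<alpha> * \<Psi> b) - (J a + 2 / \<alpha> * \<Psi> a))
      - ((J b + (b - a + 1) / \<alpha> * \<Psi> b) - (J a + 1 / \<alpha> * \<Psi> a))"
    using \<alpha> by (simp add: field_simps)
  also have "\<dots> = 0"
    unfolding 1[symmetric] 2[symmetric] by simp
  finally have "(1 / \<alpha>) * (\<Psi> b - \<Psi> a) = 0" .
  then show eq: "integral {c..d} (\<lambda>t. \<psi> (b, t)) = integral {c..d} (\<lambda>t. \<psi> (a, t))"
    using \<alpha> by (simp add: \<Psi>_def)
  show "integral {a..b} (\<lambda>s. \<phi> (s, d) - \<phi> (s, c)) = (b - a) / \<alpha> * integral {c..d} (\<lambda>t. \<psi> (a, t))"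
  proof -
    \<comment> \<open>Subtracting the equation for a point on the right from one for a point on the
      left eliminates \<open>J\<close>.\<close>
    have "D = (1 - \<alpha>) * D - (- \<alpha> * D)" by (simp add: algebra_simps)
    also have "\<dots> = (b - a + 1) / \<alpha> * \<Psi> a - 1 / \<alpha> * \<Psi> a"
      unfolding 0 1 using eq by (simp add: \<Psi>_def)
    also have "\<dots> = (b - a) / \<alpha> * \<Psi> a"
      by (simp add: left_diff_distrib add_divide_distrib distrib_right)
    finally show ?thesis by (simp add: D_def \<Psi>_def)
  qed
qed

lemma \<psi>_eq:
  assumes "t < a" "a \<le> b"
  shows "\<psi> (a, t) = \<psi> (b, t)"
proof -
  \<comment> \<open>An upper end strictly between \<open>t\<close> and \<open>a\<close> keeps the
    vertical edges inside \<open>U\<close>.\<close>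
  define e where "e = (t + a) / 2"
  have e: "t < e" "e < a" using assms by (auto simp: e_def)
  have cont: "continuous_on {t..e} (\<lambda>s. \<psi> (b, s))" "continuous_on {t..e} (\<lambda>s. \<psi> (a, s))"
    using assms e by (auto intro!: continuous_on_\<psi>_snd)
  have "\<psi> (b, t) - \<psi> (a, t) = 0"
  proof (rule continuous_eq_zero_if_integrals_zero[where h = "\<lambda>s. \<psi> (b, s) - \<psi> (a, s)"])
    fix x assume x: "x \<in> {t..e}"
    have "integral {t..x} (\<lambda>s. \<psi> (b, s) - \<psi> (a, s)) =
        integral {t..x} (\<lambda>s. \<psi> (b, s)) - integral {t..x} (\<lambda>s. \<psi> (a, s))"
      using x by (intro integral_diff integrable_continuous_interval continuous_on_subset[OF cont(1)]
          continuous_on_subset[OF cont(2)]) auto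
    also have "\<dots> = 0"
      using loop_consequences(1)[of t x a b] x assms e by simp
    finally show "integral {t..x} (\<lambda>s. \<psi> (b, s) - \<psi> (a, s)) = 0" .
  qed (use e in \<open>auto intro!: continuous_intros cont\<close>)
  then show ?thesis by simp
qed

text \<open>\<open>\<psi>\<close> depends on the second coordinate alone, which gives
  \<open>g\<close> and, by integrating twice, \<open>G2\<close> and \<open>GG2\<close>. The loop
  identities then show that \<open>\<phi> x - G2 (snd x) / \<alpha>\<close> depends on the first
  coordinate alone, which gives \<open>k\<close> and \<open>G1\<close>.\<close>

lemma score_potentials:
  obtains G1 G2 GG2 k g where "\<And>x. (G1 has_real_derivative k x) (at x)"
    "\<And>x. (GG2 has_real_derivative G2 x) (at x)" "\<And>x. (G2 has_real_derivative g x) (at x)"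
    "\<And>x. x \<in> U \<Longrightarrow> \<phi> x = k (fst x) + G2 (snd x) / \<alpha>" "\<And>x. x \<in> U \<Longrightarrow> \<psi> x = g (snd x)"
proof -
  \<comment> \<open>Any point of \<open>U\<close> with second coordinate \<open>t\<close> would
    serve; \<open>(t + 1, t)\<close> depends continuously on \<open>t\<close>. The point
    \<open>(s, s - 1)\<close> in the definition of \<open>k\<close> plays the same role.\<close>
  define g where "g = (\<lambda>t. \<psi> (t + 1, t))"
  have "continuous_on UNIV g"
    unfolding g_def
    by (rule continuous_on_compose2[OF cont_\<psi>]) (auto intro!: continuous_intros simp: U_def)
  then obtain G2 where G2: "\<And>x. (G2 has_real_derivative g x) (at x)" by (rule ex_antiderivative) blast
  then have contG2: "continuous_on UNIV G2"
    by (meson DERIV_isCont continuous_at_imp_continuous_on)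
  then obtain GG2 where GG2: "\<And>x. (GG2 has_real_derivative G2 x) (at x)" by (rule ex_antiderivative) blast
  have \<psi>g: "\<psi> x = g (snd x)" if "x \<in> U" for x
  proof (cases "fst x \<le> snd x + 1")
    case True
    then show ?thesis
      using \<psi>_eq[of "snd x" "fst x" "snd x + 1"] that by (simp add: g_def U_def)
  next
    case False
    then show ?thesis
      using \<psi>_eq[of "snd x" "snd x + 1" "fst x"] that by (simp add: g_def U_def)
  qed
  have \<phi>_diff: "\<phi> (a, d) - \<phi> (a, c) = (G2 d - G2 c) / \<alpha>" if "c \<le> d" "d < a" for a c d
  proof -
    have cont: "continuous_on {a..a + 1} (\<lambda>s. \<phi> (s, d))" "continuous_on {a..a + 1} (\<lambda>s. \<phi> (s, c))"
      using that by (auto intro!: continuous_on_\<phi>_fst)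
    have "\<phi> (a, d) - \<phi> (a, c) - (G2 d - G2 c) / \<alpha> = 0"
    proof (rule continuous_eq_zero_if_integrals_zero[where c = a and e = "a + 1"
          and h = "\<lambda>s. \<phi> (s, d) - \<phi> (s, c) - (G2 d - G2 c) / \<alpha>"])
      show "continuous_on {a..a + 1} (\<lambda>s. \<phi> (s, d) - \<phi> (s, c) - (G2 d - G2 c) / \<alpha>)"
        using \<alpha> by (intro continuous_intros cont) auto
      fix b assume b: "b \<in> {a..a + 1}"
      have "(g has_integral G2 d - G2 c) {c..d}"
        using G2 that by (intro fundamental_theorem_of_calculus)
          (auto simp flip: has_real_derivative_iff_has_vector_derivative
            intro: has_field_derivative_at_within)
      moreover have "integral {c..d} (\<lambda>t. \<psi> (a, t)) = integral {c..d} g"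
        using that by (intro integral_cong) (auto simp: \<psi>g U_def)
      ultimately have g: "integral {c..d} (\<lambda>t. \<psi> (a, t)) = G2 d - G2 c"
        by (simp add: integral_unique)
      have "integral {a..b} (\<lambda>s. \<phi> (s, d) - \<phi> (s, c) - (G2 d - G2 c) / \<alpha>) =
          integral {a..b} (\<lambda>s. \<phi> (s, d) - \<phi> (s, c)) - integral {a..b} (\<lambda>s. (G2 d - G2 c) / \<alpha>)"
        using b by (intro integral_diff integrable_continuous_interval continuous_intros
            continuous_on_subset[OF cont(1)] continuous_on_subset[OF cont(2)]) auto
      also have "\<dots> = 0"
        using loop_consequences(2)[OF that, of b] b g by simp
      finally show "integral {a..b} (\<lambda>s. \<phi> (s, d) - \<phi> (s, c) - (G2 d - G2 c) / \<alpha>) = 0" .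
    qed auto
    then show ?thesis by simp
  qed
  define k where "k = (\<lambda>s. \<phi> (s, s - 1) - G2 (s - 1) / \<alpha>)"
  have "continuous_on UNIV (\<lambda>s. \<phi> (s, s - 1))"
    by (rule continuous_on_compose2[OF cont_\<phi>]) (auto intro!: continuous_intros simp: U_def)
  moreover have "continuous_on UNIV (\<lambda>s. G2 (s - 1))"
    by (rule continuous_on_compose2[OF contG2]) (auto intro!: continuous_intros)
  ultimately have k: "continuous_on UNIV k"
    unfolding k_def using \<alpha> by (intro continuous_intros) auto
  then obtain G1 where G1: "\<And>x. (G1 has_real_derivative k x) (at x)" by (rule ex_antiderivative) blast
  have "\<phi> x = k (fst x) + G2 (snd x) / \<alpha>" if "x \<in> U" for x
  proof (cases "snd x \<le> fst x - 1")
    case True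
    then show ?thesis
      using \<phi>_diff[of "snd x" "fst x - 1" "fst x"] by (simp add: k_def diff_divide_distrib)
  next
    case False
    then show ?thesis
      using \<phi>_diff[of "fst x - 1" "snd x" "fst x"] that by (simp add: k_def U_def diff_divide_distrib)
  qed
  then show ?thesis using that[OF G1 GG2 G2 _ \<psi>g] by blast
qed

end

end

section \<open>The form of the score\<close>

text \<open>The terms with the density times \<open>G1\<close> cancel, so only the derivative
  \<open>k\<close> of \<open>G1\<close> enters.\<close>

lemma has_real_derivative_qscore:
  assumes F: "distribution_function F" and dens: "has_continuous_density F"
    and G1: "\<And>z. (G1 has_real_derivative k z) (at z)"
    and int: "\<And>z. integrable (interval_measure F) (\<lambda>y. indicator {..z} y * G1 y)"
  shows "((\<lambda>s. qscore \<alpha> G1 s F) has_real_derivative (F u - \<alpha>) * k u) (at u)"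
proof -
  interpret M: real_distribution "interval_measure F"
    by (rule real_distribution_distribution_function[OF F])
  obtain f where f: "continuous_on UNIV f" "\<And>y. 0 \<le> f y"
    and M: "interval_measure F = density lborel (\<lambda>y. ennreal (f y))"
    using has_continuous_densityE[OF dens] by metis
  have ind: "integrable (interval_measure F) (indicator {..z} :: real \<Rightarrow> real)" for z
    by (auto intro!: integrable_real_indicator simp: M.emeasure_finite less_top[symmetric])
  have "qscore \<alpha> G1 z F = (F z - \<alpha>) * G1 z - (\<integral>y. indicator {..z} y * G1 y \<partial>interval_measure F)" for z
    unfolding qscore_def using ind int M.prob_space
    by (simp add: Bochner_Integration.integral_diff measure_atMost_distribution_function[OF F])
  moreover have "continuous_on UNIV G1"
    using G1 by (meson DERIV_isCont continuous_at_imp_continuous_on)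
  then have "((\<lambda>z. (F z - \<alpha>) * G1 z - (\<integral>y. indicator {..z} y * G1 y \<partial>interval_measure F))
      has_real_derivative (F u - \<alpha>) * k u + f u * G1 u - G1 u * f u) (at u)"
    by (auto intro!: derivative_eq_intros has_real_derivative_integral_atMost[OF f M _ int]
        has_real_derivative_distribution_function[OF F f M] G1)
  ultimately show ?thesis by simp
qed

text \<open>The jump of the indicator at \<open>fst x\<close> is cancelled, since
  \<open>indicator {..fst x} y * (G1 (fst x) - G1 y)\<close> equals
  \<open>G1 (fst x) - G1 (min y (fst x))\<close>.\<close>

lemma continuous_on_var_es_score:
  assumes "continuous_on UNIV G1"
  shows "continuous_on UNIV (var_es_score \<alpha> G1 G2 GG2 (\<lambda>_. 0) x)"
proof -
  define c where "c = 1 / \<alpha>"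
  have "var_es_score \<alpha> G1 G2 GG2 (\<lambda>_. 0) x = (\<lambda>y. G1 (fst x) - G1 (min y (fst x)) - \<alpha> * G1 (fst x)
      + G2 (snd x) * (snd x - fst x + max 0 (fst x - y) * c) - GG2 (snd x))"
    by (auto simp: c_def fun_eq_iff var_es_score_eq indicator_def min_def algebra_simps)
  moreover have "continuous_on UNIV (\<lambda>y. G1 (min y (fst x)))"
    by (rule continuous_on_compose2[OF assms]) (auto intro!: continuous_intros)
  ultimately show ?thesis by (auto intro!: continuous_intros)
qed

context var_es_scores
begin

lemma U_partials_zero_imp_constant:
  fixes f :: "real \<times> real \<Rightarrow> real"
  assumes 1: "\<And>x. x \<in> U \<Longrightarrow> ((\<lambda>s. f (s, snd x)) has_real_derivative 0) (at (fst x))"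
    and 2: "\<And>x. x \<in> U \<Longrightarrow> ((\<lambda>s. f (fst x, s)) has_real_derivative 0) (at (snd x))"
    and x: "x \<in> U" "x' \<in> U"
  shows "f x = f x'"
proof -
  have H: "f (u, v) = f (u', v)" if "v < u" "v < u'" for u u' v
  proof -
    have "\<exists>c. \<forall>s\<in>{v<..}. f (s, v) = c"
      by (rule has_field_derivative_zero_constant)
         (use 1[of "(_, v)"] in \<open>auto simp: U_def intro: has_field_derivative_at_within\<close>)
    then show ?thesis using that by auto
  qed
  have Vt: "f (u, v) = f (u, v')" if "v < u" "v' < u" for u v v'
  proof -
    have "\<exists>c. \<forall>s\<in>{..<u}. f (u, s) = c"
      by (rule has_field_derivative_zero_constant)
         (use 2[of "(u, _)"] in \<open>auto simp: U_def intro: has_field_derivative_at_within\<close>)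
    then show ?thesis using that by auto
  qed
  \<comment> \<open>Moving right first to the larger first coordinate keeps the following vertical
    segment inside \<open>U\<close>.\<close>
  define m where "m = max (fst x) (fst x')"
  have "f (fst x, snd x) = f (m, snd x)" using x by (intro H) (auto simp: m_def U_def)
  also have "\<dots> = f (m, snd x')" using x by (intro Vt) (auto simp: m_def U_def)
  also have "\<dots> = f (fst x', snd x')" using x by (intro H) (auto simp: m_def U_def)
  finally show ?thesis by simp
qed

text \<open>Let \<open>R\<close> be the candidate score with zero in place of \<open>a\<close>. For
  each \<open>F\<close> the expected scores of \<open>S\<close> and \<open>R\<close> have the same
  gradient, so they differ by a constant in \<open>x\<close>. In the Dirac limit
  \<open>S x y - R x y\<close> no longer depends on \<open>x\<close>, as long as \<open>S x\<close>
  is continuous at \<open>y\<close>; this common value is \<open>a y\<close>.\<close>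

lemma score_form:
  obtains G1 G2 GG2 a where "\<And>z. (GG2 has_real_derivative G2 z) (at z)"
    "\<And>x y. x \<in> U \<Longrightarrow> isCont (S x) y \<Longrightarrow> S x y = var_es_score \<alpha> G1 G2 GG2 a x y"
proof -
  obtain \<phi> \<psi> where c: "continuous_on U \<phi>" "continuous_on U \<psi>"
    and pq: "\<And>F x. F \<in> \<F> \<Longrightarrow> x \<in> U \<Longrightarrow> p F x = \<phi> x * V F x"
    "\<And>F x. F \<in> \<F> \<Longrightarrow> x \<in> U \<Longrightarrow> q F x = \<psi> x * W F x"
    by (rule pq_factors) (rule that, assumption+)
  obtain G1 G2 GG2 k g where G1: "\<And>x. (G1 has_real_derivative k x) (at x)"
    and GG2: "\<And>x. (GG2 has_real_derivative G2 x) (at x)" and G2: "\<And>x. (G2 has_real_derivative g x) (at x)"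
    and \<phi>: "\<And>x. x \<in> U \<Longrightarrow> \<phi> x = k (fst x) + G2 (snd x) / \<alpha>"
    and \<psi>: "\<And>x. x \<in> U \<Longrightarrow> \<psi> x = g (snd x)"
    by (rule score_potentials[OF c pq]) (assumption+, rule that, assumption+)
  define R where "R = var_es_score \<alpha> G1 G2 GG2 (\<lambda>_. 0)"
  have contG1: "continuous_on UNIV G1"
    using G1 by (meson DERIV_isCont continuous_at_imp_continuous_on)
  have "G1 \<in> borel_measurable borel"
    by (rule borel_measurable_continuous_onI[OF contG1])
  have contR: "continuous_on UNIV (R x)" for x
    unfolding R_def by (rule continuous_on_var_es_score[OF contG1])
  have diff: "S x y - R x y = S x' y - R x' y"
    if x: "x \<in> U" "isCont (S x) y" and x': "x' \<in> U" "isCont (S x') y" for x x' y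
  proof -
    obtain Fn where dirac: "approaches_dirac Fn y" by (rule exE[OF ex_approaches_dirac])
    note Fn = approaches_dirac_in_class[OF dirac]
      and lim = approaches_dirac_integral(1)[OF dirac]
    have intG: "integrable (interval_measure (Fn n)) G1" for n
      by (rule approaches_dirac_integral(2)[OF dirac _ continuous_imp_locally_bounded[OF contG1]]) fact
    have ind: "integrable (interval_measure (Fn n)) (\<lambda>y. indicator {..z} y * G1 y)" for n z
      using integrable_mult_indicator[of "{..z}" "interval_measure (Fn n)" G1, OF _ intG] by simp
    have eqR: "expected R x (Fn n) = qscore \<alpha> G1 (fst x) (Fn n) + G2 (snd x) * W (Fn n) x - GG2 (snd x)" for n x
      unfolding R_def W_def
      by (subst expected_var_es_score[OF in_class(1,2)[OF Fn] ind]) auto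
    \<comment> \<open>By the choice of the potentials the partial derivatives of the expected score
      of \<open>R\<close> are \<open>\<phi>\<close> times \<open>V\<close> and \<open>\<psi>\<close>
      times \<open>W\<close>, exactly those of \<open>S\<close>.\<close>
    have const: "expected S x (Fn n) - expected R x (Fn n) = expected S x' (Fn n) - expected R x' (Fn n)" for n
    proof (rule U_partials_zero_imp_constant[OF _ _ x(1) x'(1)])
      fix z assume z: "z \<in> U"
      have "((\<lambda>s. expected S (s, snd z) (Fn n) - expected R (s, snd z) (Fn n)) has_real_derivative
          p (Fn n) z - ((Fn n (fst z) - \<alpha>) * k (fst z) + G2 (snd z) * (V (Fn n) (fst z, snd z) / \<alpha>) - 0)) (at (fst z))"
        unfolding eqR fst_conv snd_conv
        by (intro DERIV_diff DERIV_add DERIV_cmult DERIV_const has_real_derivative_p[OF Fn z]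
            has_real_derivative_qscore[OF in_class(1,4)[OF Fn] G1 ind] has_real_derivative_W_fst Fn)
      moreover have "p (Fn n) z - ((Fn n (fst z) - \<alpha>) * k (fst z) + G2 (snd z) * (V (Fn n) (fst z, snd z) / \<alpha>) - 0) = 0"
        by (simp add: pq(1)[OF Fn z] \<phi>[OF z] V_def algebra_simps add_divide_distrib diff_divide_distrib)
      ultimately show "((\<lambda>s. expected S (s, snd z) (Fn n) - expected R (s, snd z) (Fn n)) has_real_derivative 0) (at (fst z))"
        by simp
      have "((\<lambda>s. expected S (fst z, s) (Fn n) - expected R (fst z, s) (Fn n)) has_real_derivative
          q (Fn n) z - (0 + (g (snd z) * W (Fn n) (fst z, snd z) + 1 * G2 (snd z)) - G2 (snd z))) (at (snd z))"
        unfolding eqR fst_conv snd_conv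
        by (intro DERIV_diff DERIV_add DERIV_mult DERIV_const has_real_derivative_q[OF Fn z] G2 GG2
            has_real_derivative_W_snd)
      moreover have "q (Fn n) z - (0 + (g (snd z) * W (Fn n) (fst z, snd z) + 1 * G2 (snd z)) - G2 (snd z)) = 0"
        by (simp add: pq(2)[OF Fn z] \<psi>[OF z])
      ultimately show "((\<lambda>s. expected S (fst z, s) (Fn n) - expected R (fst z, s) (Fn n)) has_real_derivative 0) (at (snd z))"
        by simp
    qed
    have limS: "(\<lambda>n. expected S z (Fn n)) \<longlonglongrightarrow> S z y" if z: "z \<in> U" "isCont (S z) y" for z
    proof -
      have "integrable (interval_measure (Fn 0)) (S z)"
        using scoring z(1) Fn by (auto simp: scoring_function_def class_integrable_def)
      then have "S z \<in> borel_measurable borel"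
        using borel_measurable_integrable by (simp cong: measurable_cong_sets)
      then show ?thesis
        unfolding expected_def using z loc_bounded by (intro lim) auto
    qed
    have limR: "(\<lambda>n. expected R z (Fn n)) \<longlonglongrightarrow> R z y" for z
      unfolding expected_def
      using contR[of z] by (intro lim continuous_imp_locally_bounded borel_measurable_continuous_onI)
        (auto simp: continuous_on_eq_continuous_at)
    have "(\<lambda>n. expected S x (Fn n) - expected R x (Fn n)) \<longlonglongrightarrow> S x y - R x y"
      "(\<lambda>n. expected S x' (Fn n) - expected R x' (Fn n)) \<longlonglongrightarrow> S x' y - R x' y"
      by (intro tendsto_diff limS limR x x')+
    then show ?thesis unfolding const by (rule LIMSEQ_unique)
  qed
  \<comment> \<open>A reference point for each \<open>y\<close>. Where no point with continuity
    exists, \<open>a y\<close> is arbitrary and nothing is claimed about that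
    \<open>y\<close>.\<close>
  define c where "c = (\<lambda>y. SOME x. x \<in> U \<and> isCont (S x) y)"
  define a where "a = (\<lambda>y. S (c y) y - R (c y) y)"
  show ?thesis
  proof (rule that[of GG2 G2 G1 a])
    fix x y assume x: "x \<in> U" "isCont (S x) y"
    then have "c y \<in> U \<and> isCont (S (c y)) y"
      unfolding c_def by (rule someI[where P = "\<lambda>x. x \<in> U \<and> isCont (S x) y", OF conjI])
    then have "S x y = R x y + a y"
      using diff[OF x, of "c y"] by (simp add: a_def)
    then show "S x y = var_es_score \<alpha> G1 G2 GG2 a x y"
      by (simp add: R_def var_es_score_eq)
  qed (rule GG2)
qed

end

theorem corollary5p5:
  fixes \<alpha> :: real and \<F> :: "(real \<Rightarrow> real) set"
  assumes "0 < \<alpha>" and "\<alpha> < 1"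
    and "\<forall>F\<in>\<F>. distribution_function F \<and> finite_first_moment F \<and> (\<exists>!q. is_quantile \<alpha> F q)"
  shows
    "(\<forall>(S :: real \<times> real \<Rightarrow> real \<Rightarrow> real) (G1 :: real \<Rightarrow> real) (G2 :: real \<Rightarrow> real)
         (GG2 :: real \<Rightarrow> real) (a :: real \<Rightarrow> real).
        scoring_function \<F> A0 S \<longrightarrow>
        (\<forall>x\<in>A0. \<forall>y. S x y = var_es_score \<alpha> G1 G2 GG2 a x y) \<longrightarrow>
        (\<forall>z. (GG2 has_real_derivative G2 z) (at z)) \<longrightarrow>
        class_integrable \<F> a \<longrightarrow>
        (\<forall>x1. class_integrable \<F> (\<lambda>y. indicator {..x1} y * G1 y)) \<longrightarrow>
          (mono G1 \<and> mono GG2 \<and> convex_on UNIV GG2 \<longrightarrow>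
             consistent \<F> A0 (VaR_ES \<alpha>) S) \<and>
          (mono G1 \<and> strict_mono GG2 \<and> strictly_convex GG2 \<longrightarrow>
             strictly_consistent \<F> A0 (VaR_ES \<alpha>) S))
     \<and>
     (\<forall>A. A = VaR_ES \<alpha> ` \<F> \<longrightarrow>
        (\<forall>F\<in>\<F>. has_continuous_density F) \<longrightarrow>
        convex_class \<F> \<and> starlike (interior A) \<longrightarrow>
        (\<forall>x\<in>interior A. \<exists>F1\<in>\<F>. \<exists>F2\<in>\<F>. \<exists>F3\<in>\<F>.
           0 \<in> interior (convex hull {expected (ident_V \<alpha>) x F1, expected (ident_V \<alpha>) x F2,
                                        expected (ident_V \<alpha>) x F3})) \<longrightarrow>
        (\<forall>y. \<exists>Fn :: nat \<Rightarrow> real \<Rightarrow> real.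
           (\<forall>n. Fn n \<in> \<F>) \<and>
           weak_conv_m (\<lambda>n. interval_measure (Fn n)) (return borel y) \<and>
           (\<exists>K. compact K \<and> (\<forall>n. dist_support (Fn n) \<subseteq> K))) \<longrightarrow>
        (\<forall>t \<in> interior A \<inter> VaR_ES \<alpha> ` \<F>. \<exists>F1\<in>\<F>. \<exists>F2\<in>\<F>.
           VaR_ES \<alpha> F1 = t \<and> VaR_ES \<alpha> F2 = t \<and> partial1_V1 \<alpha> t F1 \<noteq> partial1_V1 \<alpha> t F2) \<longrightarrow>
        (\<forall>S :: real \<times> real \<Rightarrow> real \<Rightarrow> real.
           scoring_function \<F> A S \<longrightarrow>
           strictly_consistent \<F> A (VaR_ES \<alpha>) S \<longrightarrow>
           (\<forall>x\<in>A. locally_bounded (S x)) \<longrightarrow>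
           (\<forall>F\<in>\<F>. score_smooth (interior A) (VaR_ES \<alpha> F) (\<lambda>x. expected S x F)) \<longrightarrow>
           A \<times> UNIV - {(x, y). isCont (ident_V \<alpha> x) y \<and> isCont (S x) y} \<in> null_sets lebesgue \<longrightarrow>
           (\<exists>G1 G2 GG2 a :: real \<Rightarrow> real.
              (\<forall>z. (GG2 has_real_derivative G2 z) (at z)) \<and>
              (AE (x, y) in lebesgue. x \<in> A \<longrightarrow> S x y = var_es_score \<alpha> G1 G2 GG2 a x y))))"
proof (intro conjI allI impI)
  fix S G1 G2 GG2 a
  assume S: "\<forall>x\<in>A0. \<forall>y. S x y = var_es_score \<alpha> G1 G2 GG2 a x y"
    and GG2: "\<forall>z. (GG2 has_real_derivative G2 z) (at z)"
    and int: "class_integrable \<F> a" "\<forall>x1. class_integrable \<F> (\<lambda>y. indicator {..x1} y * G1 y)"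
  note score = VaR_ES_score_consistent[OF assms S GG2 int]
  show "consistent \<F> A0 (VaR_ES \<alpha>) S" if "mono G1 \<and> mono GG2 \<and> convex_on UNIV GG2"
    using score(1) that by blast
  show "strictly_consistent \<F> A0 (VaR_ES \<alpha>) S"
    if "mono G1 \<and> strict_mono GG2 \<and> strictly_convex GG2"
    using score(2) that strict_mono_mono strictly_convex_imp_convex_on by blast
next
  fix A and S :: "real \<times> real \<Rightarrow> real \<Rightarrow> real"
  assume A: "A = VaR_ES \<alpha> ` \<F>"
    and density: "\<forall>F\<in>\<F>. has_continuous_density F"
    and convex: "convex_class \<F> \<and> starlike (interior A)"
    and dirac: "\<forall>y. \<exists>Fn :: nat \<Rightarrow> real \<Rightarrow> real.
           (\<forall>n. Fn n \<in> \<F>) \<and>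
           weak_conv_m (\<lambda>n. interval_measure (Fn n)) (return borel y) \<and>
           (\<exists>K. compact K \<and> (\<forall>n. dist_support (Fn n) \<subseteq> K))"
    and sep: "\<forall>t \<in> interior A \<inter> VaR_ES \<alpha> ` \<F>. \<exists>F1\<in>\<F>. \<exists>F2\<in>\<F>.
           VaR_ES \<alpha> F1 = t \<and> VaR_ES \<alpha> F2 = t \<and> partial1_V1 \<alpha> t F1 \<noteq> partial1_V1 \<alpha> t F2"
    and S: "scoring_function \<F> A S" "strictly_consistent \<F> A (VaR_ES \<alpha>) S"
      "\<forall>x\<in>A. locally_bounded (S x)"
      "\<forall>F\<in>\<F>. score_smooth (interior A) (VaR_ES \<alpha> F) (\<lambda>x. expected S x F)"
    and null: "A \<times> UNIV - {(x, y). isCont (ident_V \<alpha> x) y \<and> isCont (S x) y} \<in> null_sets lebesgue"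
  interpret var_es_class \<alpha> \<F>
    using assms density convex dirac by unfold_locales auto
  \<comment> \<open>The action domain is the open half plane, so interior and domain coincide and
    all conditions on the interior hold throughout \<open>A\<close>.\<close>
  have AU: "A = U" "interior A = U"
    using A image_VaR_ES open_U by (auto simp: interior_open)
  interpret var_es_scores \<alpha> \<F> S
    using S sep unfolding AU strictly_consistent_def interior_open[OF open_U] image_VaR_ES
    by unfold_locales auto
  obtain G1 G2 GG2 a where GG2: "\<And>z. (GG2 has_real_derivative G2 z) (at z)"
    and form: "\<And>x y. x \<in> U \<Longrightarrow> isCont (S x) y \<Longrightarrow> S x y = var_es_score \<alpha> G1 G2 GG2 a x y"
    by (rule score_form) (rule that, assumption+)
  \<comment> \<open>Outside the given null set every \<open>x\<close> in \<open>A\<close> has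
    \<open>S x\<close> continuous at \<open>y\<close>, where the form has been shown.\<close>
  have "AE (x, y) in lebesgue. x \<in> A \<longrightarrow> S x y = var_es_score \<alpha> G1 G2 GG2 a x y"
    by (rule AE_I'[OF null]) (use form in \<open>auto simp: AU\<close>)
  with GG2 show "\<exists>G1 G2 GG2 a. (\<forall>z. (GG2 has_real_derivative G2 z) (at z)) \<and>
      (AE (x, y) in lebesgue. x \<in> A \<longrightarrow> S x y = var_es_score \<alpha> G1 G2 GG2 a x y)"
    by blast
qed

end
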